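(* Let $\mathbb X=\mathbb T^d=\mathbb R^d/\mathbb Z^d$ with $d\ge2$, let $s>d/2$, and let $K$ be a continuous symmetric positive definite kernel on $\mathbb T^d$ with $H_K(\mathbb T^d)=H^s(\mathbb T^d)$ with equivalent norms. Then for every $\mu\in\mathcal P(\mathbb T^d)$ absolutely continuous with Lipschitz continuous density $\rho\in H^s(\mathbb T^d)$ there is a constant $c>0$, depending on $d$, $K$ and $\rho$, such that for all $L\ge1$ $$\min_{\nu\in\mathcal P^{\mathrm{Acurve}}_L(\mathbb T^d)}\mathscr D_K(\mu,\nu)\le c\,L^{-\frac{s}{d-1}}.$$
   Context: $\mathbb T^d$ carries the flat Riemannian metric (distance $\mathrm{dist}$) and normalized Lebesgue (Haar) measure $\sigma$. $H^s(\mathbb T^d)=\{f\in L^2:\sum_{k\in\mathbb Z^d}(1+4\pi^2|k|^2)^s|\hat f_k|^2<\infty\}$ with $\hat f_k=\int f(x)e^{-2\pi i\langle k,x\rangle}dx$. $H_K$: reproducing kernel Hilbert space of $K$; $\mathscr D_K(\mu,\nu)=\sup_{\|\varphi\|_{H_K}\le1}|\int\varphi\,d(\mu-\nu)|$. $\mathrm{Lip}(\mathbb T^d)$: Lipschitz $\gamma\colon[0,1]\to\mathbb T^d$ with $\gamma(0)=\gamma(1)$, $L(\gamma)$ its optimal Lipschitz constant; $\lambda$ Lebesgue measure on $[0,1]$; $\gamma_*$ pushforward. $\mathcal P^{\mathrm{Acurve}}_L(\mathbb T^d)=\{\gamma_*(\rho'\lambda):\gamma\in\mathrm{Lip}(\mathbb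 T^d),L(\gamma)\le L,\ \rho'\ge0,\int_0^1\rho'=1,\ \rho'\text{ Lipschitz with }L(\rho')\le L\}$. *)

theory Defs
  imports "HOL-Analysis.Analysis"
begin

text \<open>The torus T^d = R^d / Z^d is modelled by real^'d; functions on the torus are
  Z^d-periodic functions on real^'d; the fundamental domain is the unit cube cbox 0 One.\<close>

definition int_vec :: "int ^ 'd \<Rightarrow> real ^ 'd" where
  "int_vec k = (\<chi> i. of_int (k $ i))"

definition tor_periodic :: "(real ^ 'd \<Rightarrow> 'b) \<Rightarrow> bool" where
  "tor_periodic f \<longleftrightarrow> (\<forall>x k. f (x + int_vec k) = f x)"

definition tor_dist :: "real ^ 'd \<Rightarrow> real ^ 'd \<Rightarrow> real" where
  "tor_dist x y = (INF k :: int ^ 'd. norm (x - y - int_vec k))"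

definition tor_lipschitz :: "(real ^ 'd \<Rightarrow> real) \<Rightarrow> bool" where
  "tor_lipschitz f \<longleftrightarrow> (\<exists>C. \<forall>x y. \<bar>f x - f y\<bar> \<le> C * tor_dist x y)"

abbreviation tor_measure :: "(real ^ 'd) measure" where
  "tor_measure \<equiv> lebesgue_on (cbox 0 One)"

definition fourier_coeff :: "(real ^ 'd \<Rightarrow> real) \<Rightarrow> int ^ 'd \<Rightarrow> complex" where
  "fourier_coeff f k = integral\<^sup>L tor_measure
     (\<lambda>x. complex_of_real (f x) * cis (- 2 * pi * (\<Sum>i\<in>UNIV. of_int (k $ i) * x $ i)))"

definition sob_weight :: "real \<Rightarrow> int ^ 'd \<Rightarrow> real" where
  "sob_weight s k = (1 + 4 * pi\<^sup>2 * (\<Sum>i\<in>UNIV. (of_int (k $ i))\<^sup>2)) powr s"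

definition in_Hs :: "real \<Rightarrow> (real ^ 'd \<Rightarrow> real) \<Rightarrow> bool" where
  "in_Hs s f \<longleftrightarrow> tor_periodic f \<and> f \<in> borel_measurable tor_measure \<and>
     integrable tor_measure (\<lambda>x. (f x)\<^sup>2) \<and>
     (\<lambda>k. sob_weight s k * (cmod (fourier_coeff f k))\<^sup>2) summable_on UNIV"

definition Hs_norm :: "real \<Rightarrow> (real ^ 'd \<Rightarrow> real) \<Rightarrow> real" where
  "Hs_norm s f = sqrt (\<Sum>\<^sub>\<infinity>k. sob_weight s k * (cmod (fourier_coeff f k))\<^sup>2)"

subsection \<open>Reproducing kernel Hilbert space (Moore--Aronszajn completion)\<close>

definition kfun :: "('a \<Rightarrow> 'a \<Rightarrow> real) \<Rightarrow> (real \<times> 'a) list \<Rightarrow> 'a \<Rightarrow> real" where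
  "kfun K xs = (\<lambda>y. \<Sum>(a, x)\<leftarrow>xs. a * K x y)"

definition knorm2 :: "('a \<Rightarrow> 'a \<Rightarrow> real) \<Rightarrow> (real \<times> 'a) list \<Rightarrow> real" where
  "knorm2 K xs = (\<Sum>(a, x)\<leftarrow>xs. \<Sum>(b, z)\<leftarrow>xs. a * b * K x z)"

definition kdiff :: "(real \<times> 'a) list \<Rightarrow> (real \<times> 'a) list \<Rightarrow> (real \<times> 'a) list" where
  "kdiff xs ys = xs @ map (\<lambda>(b, z). (- b, z)) ys"

definition rkhs_approx :: "('a \<Rightarrow> 'a \<Rightarrow> real) \<Rightarrow> ('a \<Rightarrow> real) \<Rightarrow> (nat \<Rightarrow> (real \<times> 'a) list) \<Rightarrow> bool" where
  "rkhs_approx K f c \<longleftrightarrow>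
     (\<forall>e>0. \<exists>N. \<forall>m\<ge>N. \<forall>n\<ge>N. knorm2 K (kdiff (c m) (c n)) < e) \<and>
     (\<forall>y. (\<lambda>n. kfun K (c n) y) \<longlonglongrightarrow> f y)"

definition in_rkhs :: "('a \<Rightarrow> 'a \<Rightarrow> real) \<Rightarrow> ('a \<Rightarrow> real) \<Rightarrow> bool" where
  "in_rkhs K f \<longleftrightarrow> (\<exists>c. rkhs_approx K f c)"

definition rkhs_norm :: "('a \<Rightarrow> 'a \<Rightarrow> real) \<Rightarrow> ('a \<Rightarrow> real) \<Rightarrow> real" where
  "rkhs_norm K f = Inf {L. \<exists>c. rkhs_approx K f c \<and> (\<lambda>n. sqrt (knorm2 K (c n))) \<longlonglongrightarrow> L}"

definition pos_def_kernel :: "('a \<Rightarrow> 'a \<Rightarrow> real) \<Rightarrow> bool" where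
  "pos_def_kernel K \<longleftrightarrow> (\<forall>x y. K x y = K y x) \<and> (\<forall>xs. knorm2 K xs \<ge> 0)"

definition dens_int :: "(real ^ 'd \<Rightarrow> real) \<Rightarrow> (real ^ 'd \<Rightarrow> real) \<Rightarrow> real" where
  "dens_int \<rho> \<phi> = integral\<^sup>L tor_measure (\<lambda>x. \<phi> x * \<rho> x)"

text \<open>Integral of phi against the push-forward gamma_*(rho' lambda).\<close>
definition curve_int :: "(real \<Rightarrow> real ^ 'd) \<Rightarrow> (real \<Rightarrow> real) \<Rightarrow> (real ^ 'd \<Rightarrow> real) \<Rightarrow> real" where
  "curve_int \<gamma> w \<phi> = integral\<^sup>L (lebesgue_on {0..1}) (\<lambda>t. \<phi> (\<gamma> t) * w t)"

definition discrepancy_curve ::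
  "(real ^ 'd \<Rightarrow> real ^ 'd \<Rightarrow> real) \<Rightarrow> (real ^ 'd \<Rightarrow> real) \<Rightarrow> (real \<Rightarrow> real ^ 'd) \<Rightarrow> (real \<Rightarrow> real) \<Rightarrow> ereal" where
  "discrepancy_curve K \<rho> \<gamma> w =
     (SUP \<phi> \<in> {\<phi>. in_rkhs K \<phi> \<and> rkhs_norm K \<phi> \<le> 1}. ereal \<bar>dens_int \<rho> \<phi> - curve_int \<gamma> w \<phi>\<bar>)"

definition acurve :: "real \<Rightarrow> (real \<Rightarrow> real ^ 'd) \<Rightarrow> (real \<Rightarrow> real) \<Rightarrow> bool" where
  "acurve L \<gamma> w \<longleftrightarrow>
     (\<forall>t\<in>{0..1}. \<forall>u\<in>{0..1}. tor_dist (\<gamma> t) (\<gamma> u) \<le> L * \<bar>t - u\<bar>) \<and>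
     tor_dist (\<gamma> 0) (\<gamma> 1) = 0 \<and>
     (\<forall>t\<in>{0..1}. w t \<ge> 0) \<and>
     integral\<^sup>L (lebesgue_on {0..1}) w = 1 \<and>
     L-lipschitz_on {0..1} w"

end

theory Submission
  imports Defs
begin

text \<open>The curve is a closed geodesic. For N \<ge> 1 let v have the entries 1, N, ..., N^(d-1) and put
  \<gamma>(t) = t v, a curve of length O(N^(d-1)). Its uniform measure has Fourier coefficient 1 at the
  frequencies k orthogonal to v and 0 elsewhere. By uniqueness of base-N digits, the lattice of these
  k is N-separated in the maximum norm, hence the sum of (1 + |k|^2)^(-s) over its nonzero points is
  O(N^(-2s)). As s > d/2, this gives a quadrature error O(N^(-s)) for the products \<phi> \<rho> with \<phi> in the
  unit ball of the RKHS: split the weight between the two factors and apply the arithmetic-geometric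
  mean inequality to the convolution of the Fourier coefficients. The weight on the curve is
  \<rho>(\<gamma>(t)), normalised; its normalising constant is 1 + O(N^(-s)) by the same estimate with \<phi> = 1.
  Finally N is chosen with N^(d-1) of the order of L; bounded L are covered by a constant curve.\<close>

subsection \<open>Periodic functions on the unit cube\<close>

text \<open>The exponent comes from the dual lattice: the integer frequencies orthogonal to v have
  rank d-1 and covolume of order |v|, so their separation is at most of order |v|^(1/(d-1)). Powers
  of N attain this with |v| of order N^(d-1), and N^(-s) becomes L^(-s/(d-1)). The obstacle is that
  the curve is a null set: integrals along it see point values, whereas membership in H^s and the
  norm equivalence determine functions only almost everywhere. Hence the work on continuity of RKHS
  functions and on Fourier series converging at every point; s > d/2 makes the inverse weights
  summable and thereby the coefficients absolutely summable. The curve has constant speed and the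
  density of \<mu> goes into the weight alone, so the product \<phi> \<rho> has to be integrated,
  and the Lipschitz bound on \<rho> controls the weight. The product is never shown to lie in H^s:
  its coefficients stay a double series over pairs (j, l), and the error is the part with j + l a
  nonzero point of the dual lattice.\<close>

lemma int_vec_simps [simp]:
  "int_vec k $ i = of_int (k $ i)" "int_vec (k + l) = int_vec k + int_vec l"
  "int_vec (- k) = - int_vec k" "int_vec 0 = 0"
  by (simp_all add: int_vec_def vec_eq_iff)

lemma mem_unit_cube: "(x :: real ^ 'd) \<in> cbox 0 One \<longleftrightarrow> (\<forall>i. 0 \<le> x $ i \<and> x $ i \<le> 1)"
proof -
  have "One \<bullet> axis i (1 :: real) = (1 :: real)" for i :: 'd
    using inner_sum_left_Basis[of "axis i (1 :: real)" "\<lambda>_. 1"] by simp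
  then show ?thesis by (auto simp: mem_box Basis_vec_def inner_axis)
qed

lemma translate_into_cube: "\<exists>k. (x :: real ^ 'd) + int_vec k \<in> cbox 0 One"
  by (rule exI[of _ "\<chi> i. - \<lfloor>x $ i\<rfloor>"]) (auto simp: mem_unit_cube, linarith)

lemma torus_bounded:
  fixes f :: "real ^ 'd \<Rightarrow> 'b :: real_normed_vector"
  assumes "continuous_on UNIV f" "tor_periodic f"
  shows "\<exists>B>0. \<forall>x. norm (f x) \<le> B"
proof -
  have "bounded (f ` cbox 0 One)"
    using assms(1) by (intro compact_imp_bounded compact_continuous_image)
      (auto intro: continuous_on_subset)
  then obtain B where B: "B > 0" "\<And>x. x \<in> cbox 0 One \<Longrightarrow> norm (f x) \<le> B"
    by (metis bounded_pos imageI)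
  have "norm (f x) \<le> B" for x
    using translate_into_cube[of x] assms(2) B(2) unfolding tor_periodic_def by metis
  with B(1) show ?thesis by blast
qed

text \<open>The points of the open cube where f is nonzero form an open negligible set, hence an
  empty one; continuity carries the zeros to the closed cube and periodicity to the whole space.
  Identities that hold almost everywhere thus become usable on a curve of measure zero.\<close>

lemma continuous_AE_zero:
  fixes f :: "real ^ 'd \<Rightarrow> 'b :: real_normed_vector"
  assumes c: "continuous_on UNIV f" and p: "tor_periodic f"
    and ae: "AE x in tor_measure. f x = 0"
  shows "f x = 0"
proof -
  let ?U = "box 0 One :: (real ^ 'd) set"
  have ae': "AE x in lebesgue. x \<in> cbox 0 One \<longrightarrow> f x = 0"
    using ae by (simp add: AE_restrict_space_iff)
  define S where "S = {x \<in> ?U. f x \<noteq> 0}"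
  have "open S" unfolding S_def
  proof -
    have "open (?U \<inter> f -` (- {0}))"
      using c by (intro open_Int open_vimage) auto
    moreover have "?U \<inter> f -` (- {0}) = {x \<in> ?U. f x \<noteq> 0}" by auto
    ultimately show "open {x \<in> ?U. f x \<noteq> 0}" by simp
  qed
  moreover obtain N where N: "N \<in> null_sets lebesgue" "{x. \<not> (x \<in> cbox 0 One \<longrightarrow> f x = 0)} \<subseteq> N"
    using ae' unfolding eventually_ae_filter by auto
  have "S \<subseteq> N"
    using N(2) box_subset_cbox[of 0 "One :: real ^ 'd"] by (auto simp: S_def)
  then have "negligible S"
    using N(1) negligible_subset negligible_iff_null_sets by blast
  ultimately have "S = {}"
    using open_not_negligible by blast
  then have z: "f x = 0" if "x \<in> ?U" for x using that by (auto simp: S_def)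
  have "closed {x. f x = 0}"
    using c by (intro closed_Collect_eq) auto
  moreover have "closure ?U = cbox 0 One"
    by (rule closure_box) (auto simp: box_ne_empty)
  ultimately have "f x = 0" if "x \<in> cbox 0 One" for x
    using closure_minimal[of ?U "{x. f x = 0}"] z that by auto
  then show ?thesis
    using translate_into_cube[of x] p unfolding tor_periodic_def by metis
qed

subsection \<open>The reproducing kernel Hilbert space\<close>

lemma kfun_kdiff: "kfun K (kdiff xs ys) y = kfun K xs y - kfun K ys y"
proof -
  have "(\<Sum>(a, x)\<leftarrow>map (\<lambda>(b, z). (- b, z)) ys. a * K x y) = - (\<Sum>(a, x)\<leftarrow>ys. a * K x y)"
    by (induction ys) auto
  then show ?thesis by (simp add: kfun_def kdiff_def)
qed

text \<open>Adding a multiple t of the kernel function at y gives a quadratic polynomial in t whose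
  linear coefficient is twice the value at y; its nonnegativity yields Cauchy-Schwarz.\<close>

lemma knorm2_Cons:
  assumes "pos_def_kernel K"
  shows "knorm2 K ((t, y) # xs) = t\<^sup>2 * K y y + 2 * t * kfun K xs y + knorm2 K xs"
proof -
  have sym: "K x y = K y x" for x y using assms by (simp add: pos_def_kernel_def)
  have 1: "(\<Sum>(b, z)\<leftarrow>xs. t * b * K y z) = t * kfun K xs y"
    unfolding kfun_def
  proof (induction xs)
    case (Cons p xs)
    then show ?case using sym[of y "snd p"] by (simp add: case_prod_unfold distrib_left)
  qed simp
  have 2: "(\<Sum>(a, x)\<leftarrow>xs. a * t * K x y + (\<Sum>(b, z)\<leftarrow>ys. a * b * K x z)) =
     t * kfun K xs y + (\<Sum>(a, x)\<leftarrow>xs. \<Sum>(b, z)\<leftarrow>ys. a * b * K x z)" for ys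
    unfolding kfun_def by (induction xs) (simp_all add: case_prod_unfold distrib_left add_ac mult_ac)
  have "knorm2 K ((t, y) # xs) = t * t * K y y + (\<Sum>(b, z)\<leftarrow>xs. t * b * K y z)
      + (\<Sum>(a, x)\<leftarrow>xs. a * t * K x y + (\<Sum>(b, z)\<leftarrow>xs. a * b * K x z))"
    by (simp add: knorm2_def)
  also have "\<dots> = t * t * K y y + t * kfun K xs y + (t * kfun K xs y + knorm2 K xs)"
    unfolding 1 2 by (simp only: knorm2_def)
  finally show ?thesis by (simp add: power2_eq_square)
qed

text \<open>Cauchy-Schwarz for point evaluation: the quadratic is tested at t = - f(y) / B. A
  positive upper bound B in place of \<open>K y y\<close> avoids the degenerate case
  \<open>K y y = 0\<close> and allows one constant for all y.\<close>

lemma kfun_bound: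
  assumes "pos_def_kernel K" "K y y \<le> B" "B > 0"
  shows "(kfun K xs y)\<^sup>2 \<le> knorm2 K xs * B"
proof -
  let ?f = "kfun K xs y"
  have "0 \<le> knorm2 K ((- ?f / B, y) # xs)"
    using assms(1) by (simp add: pos_def_kernel_def)
  also have "\<dots> = (?f / B)\<^sup>2 * K y y - 2 * ?f\<^sup>2 / B + knorm2 K xs"
    by (simp add: knorm2_Cons[OF assms(1)] power2_eq_square)
  also have "\<dots> \<le> (?f / B)\<^sup>2 * B - 2 * ?f\<^sup>2 / B + knorm2 K xs"
    using assms(2) by (intro add_mono diff_mono mult_left_mono) auto
  also have "\<dots> = knorm2 K xs - ?f\<^sup>2 / B"
    using assms(3) by (simp add: field_simps power2_eq_square)
  finally show ?thesis using assms(3) by (simp add: field_simps)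
qed

lemma continuous_on_kfun:
  fixes K :: "'a :: topological_space \<Rightarrow> 'a \<Rightarrow> real"
  assumes "continuous_on UNIV (\<lambda>(x, y). K x y)"
  shows "continuous_on UNIV (kfun K xs)"
proof -
  have K: "continuous_on UNIV (K x)" for x
  proof -
    have "continuous_on UNIV ((\<lambda>(x, y). K x y) \<circ> (\<lambda>y. (x, y)))"
      by (intro continuous_on_compose continuous_on_Pair continuous_on_const continuous_on_id
          continuous_on_subset[OF assms]) simp
    then show ?thesis by (simp add: o_def)
  qed
  show ?thesis unfolding kfun_def
    by (induction xs) (simp_all add: case_prod_unfold K continuous_on_add continuous_on_mult_left)
qed

text \<open>With a bounded diagonal, \<open>kfun_bound\<close> applied to differences turns Cauchy
  in the kernel seminorm into uniformly Cauchy, so the pointwise limit of the continuous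
  \<open>kfun K (c n)\<close> is a uniform limit.\<close>

lemma in_rkhs_continuous:
  fixes K :: "real ^ 'd \<Rightarrow> real ^ 'd \<Rightarrow> real"
  assumes K_cont: "continuous_on UNIV (\<lambda>(x, y). K x y)"
    and pd: "pos_def_kernel K"
    and B: "B > 0" "\<And>y. K y y \<le> B"
    and f: "in_rkhs K f"
  shows "continuous_on UNIV f"
proof -
  obtain c where cauchy: "\<And>e. e > 0 \<Longrightarrow> \<exists>N. \<forall>m\<ge>N. \<forall>n\<ge>N. knorm2 K (kdiff (c m) (c n)) < e"
    and lim: "\<And>y. (\<lambda>n. kfun K (c n) y) \<longlonglongrightarrow> f y"
    using f by (auto simp: in_rkhs_def rkhs_approx_def)
  have "uniform_limit UNIV (\<lambda>n. kfun K (c n)) f sequentially"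
  proof (rule uniform_limitI)
    fix e :: real assume e: "e > 0"
    obtain N where N: "\<And>m n. m \<ge> N \<Longrightarrow> n \<ge> N \<Longrightarrow> knorm2 K (kdiff (c m) (c n)) < (e/2)\<^sup>2 / B"
      using cauchy[of "(e/2)\<^sup>2 / B"] e B(1) by auto
    have "dist (kfun K (c m) y) (f y) < e" if m: "m \<ge> N" for m y
    proof -
      have "\<bar>kfun K (c m) y - kfun K (c n) y\<bar> \<le> e / 2" if "n \<ge> N" for n
      proof (rule power2_le_imp_le)
        have "(kfun K (c m) y - kfun K (c n) y)\<^sup>2 \<le> knorm2 K (kdiff (c m) (c n)) * B"
          using kfun_bound[OF pd B(2) B(1)] by (simp flip: kfun_kdiff)
        also have "\<dots> \<le> (e/2)\<^sup>2 / B * B"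
          using N[OF m that] B(1) by (intro mult_right_mono) auto
        finally show "\<bar>kfun K (c m) y - kfun K (c n) y\<bar>\<^sup>2 \<le> (e/2)\<^sup>2"
          using B(1) by simp
      qed (use e in auto)
      moreover have "(\<lambda>n. \<bar>kfun K (c m) y - kfun K (c n) y\<bar>) \<longlonglongrightarrow> \<bar>kfun K (c m) y - f y\<bar>"
        by (intro tendsto_intros lim)
      ultimately have "\<bar>kfun K (c m) y - f y\<bar> \<le> e / 2"
        by (intro LIMSEQ_le_const2) auto
      then show ?thesis using e by (simp add: dist_real_def)
    qed
    then show "\<forall>\<^sub>F n in sequentially. \<forall>x\<in>UNIV. dist (kfun K (c n) x) (f x) < e"
      using eventually_sequentially by auto
  qed
  moreover have "\<forall>\<^sub>F n in sequentially. continuous_on UNIV (kfun K (c n))"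
    using continuous_on_kfun[OF K_cont] by simp
  ultimately show ?thesis
    by (intro uniform_limit_theorem[where F = sequentially]) simp_all
qed

subsection \<open>Characters and Fourier series\<close>

definition tchar :: "int ^ 'd \<Rightarrow> real ^ 'd \<Rightarrow> complex" where
  "tchar k x = cis (2 * pi * (\<Sum>i\<in>UNIV. of_int (k $ i) * x $ i))"

lemma norm_tchar [simp]: "norm (tchar k x) = 1"
  by (simp add: tchar_def)

lemma tchar_zero [simp]: "tchar 0 x = 1"
  by (simp add: tchar_def)

lemma tchar_add: "tchar (k + l) x = tchar k x * tchar l x"
  by (simp add: tchar_def cis_mult distrib_right sum.distrib distrib_left)

lemma tchar_uminus: "tchar (- k) x = cis (- 2 * pi * (\<Sum>i\<in>UNIV. of_int (k $ i) * x $ i))"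
  by (simp add: tchar_def sum_negf)

lemma tchar_uminus_cnj: "tchar (- k) x = cnj (tchar k x)"
  by (simp add: tchar_def cis_cnj sum_negf)

lemma tor_periodic_tchar: "tor_periodic (tchar k)"
proof -
  have "tchar k (x + int_vec l) = tchar k x" for x l
  proof -
    have "tchar k (x + int_vec l) =
        cis (2 * pi * (\<Sum>i\<in>UNIV. of_int (k $ i) * x $ i)
           + 2 * pi * of_int (\<Sum>i\<in>UNIV. k $ i * l $ i))"
      by (simp add: tchar_def distrib_left sum.distrib)
    also have "\<dots> = tchar k x * cis (2 * pi * of_int (\<Sum>i\<in>UNIV. k $ i * l $ i))"
      by (simp only: cis_mult tchar_def)
    also have "cis (2 * pi * of_int (\<Sum>i\<in>UNIV. k $ i * l $ i)) = 1"
      by (rule cis_multiple_2pi) (rule Ints_of_int)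
    finally have "tchar k (x + int_vec l) = tchar k x * 1" .
    then show ?thesis by simp
  qed
  then show ?thesis by (simp add: tor_periodic_def)
qed

lemma continuous_on_tchar [continuous_intros]: "continuous_on A (tchar k)"
  unfolding tchar_def by (intro continuous_intros)

lemma fourier_coeff_tchar:
  "fourier_coeff f k = integral\<^sup>L tor_measure (\<lambda>x. complex_of_real (f x) * tchar (- k) x)"
  by (simp only: fourier_coeff_def tchar_uminus)

lemma integrable_continuous_tor:
  fixes f :: "real ^ 'd \<Rightarrow> 'b :: euclidean_space"
  assumes "continuous_on UNIV f"
  shows "integrable tor_measure f"
proof -
  have "f absolutely_integrable_on cbox 0 One"
    by (intro absolutely_integrable_continuous continuous_on_subset[OF assms]) auto
  then show ?thesis
    by (simp add: integrable_restrict_space set_integrable_def)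
qed

lemma integrable_continuous_unit:
  fixes f :: "real \<Rightarrow> 'b :: euclidean_space"
  assumes "continuous_on UNIV f"
  shows "integrable (lebesgue_on {0..1}) f"
proof -
  have "f absolutely_integrable_on cbox 0 1"
    by (intro absolutely_integrable_continuous continuous_on_subset[OF assms]) auto
  then show ?thesis
    by (simp add: integrable_restrict_space set_integrable_def)
qed

lemma measure_tor [simp]: "measure tor_measure (cbox 0 One :: (real ^ 'd) set) = 1"
  by (simp add: measure_restrict_space)

lemma measure_unit [simp]: "measure (lebesgue_on {0..1}) {0..1 :: real} = 1"
  by (simp add: measure_restrict_space)

lemma finite_measure_tor: "finite_measure (tor_measure :: (real ^ 'd) measure)"
  by (rule finite_measure_lebesgue_on) simp

lemma finite_measure_unit: "finite_measure (lebesgue_on {0..1 :: real})"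
  by (rule finite_measure_lebesgue_on) simp

lemma integral_cis_unit:
  "integral\<^sup>L (lebesgue_on {0..1}) (\<lambda>t. cis (2 * pi * of_int m * t)) = (if m = 0 then 1 else 0)"
proof (cases "m = 0")
  case True
  then show ?thesis by simp
next
  case False
  define c :: complex where "c = 2 * pi * of_int m * \<i>"
  have c0: "c \<noteq> 0" using False by (simp add: c_def)
  let ?F = "\<lambda>t::real. exp (c * of_real t) / c"
  have e: "cis (2 * pi * of_int m * t) = exp (c * of_real t)" for t :: real
    by (simp add: c_def cis_conv_exp mult_ac)
  have "((\<lambda>t::real. exp (c * of_real t)) has_integral (?F 1 - ?F 0)) {0..1}"
  proof (rule fundamental_theorem_of_calculus)
    fix t :: real
    have "((\<lambda>z. exp (c * z) / c) has_field_derivative exp (c * of_real t)) (at (of_real t))"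
      using c0 by (auto intro!: derivative_eq_intros)
    then show "(?F has_vector_derivative exp (c * of_real t)) (at t within {0..1})"
      using has_vector_derivative_real_field has_vector_derivative_at_within by blast
  qed simp
  moreover have "exp c = 1"
    using cis_multiple_2pi[of "of_int m"] by (simp add: c_def cis_conv_exp mult_ac)
  ultimately have "((\<lambda>t. cis (2 * pi * of_int m * t)) has_integral 0) {0..1}"
    by (simp add: e)
  moreover have "(\<lambda>t. cis (2 * pi * of_int m * t)) absolutely_integrable_on cbox 0 1"
    by (intro absolutely_integrable_continuous continuous_intros)
  ultimately show ?thesis
    using False lebesgue_integral_eq_integral[of "{0..1}" "\<lambda>t. cis (2 * pi * of_int m * t)"]
    by (simp add: integrable_restrict_space set_integrable_def integral_unique)
qed

text \<open>Orthogonality of characters by Fubini: the indicator of the cube and the character both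
  factor over the coordinates, so the integral is a product of one-dimensional ones.\<close>

lemma integral_tchar:
  "integral\<^sup>L tor_measure (tchar (k :: int ^ 'd)) = (if k = 0 then 1 else 0)"
proof -
  let ?c = "\<lambda>i t. indicator {0..1::real} t *\<^sub>R cis (2 * pi * of_int (k $ i) * t)"
  \<comment> \<open>\<open>lborel\<close> is a product measure indexed by basis vectors, not by the
    index type \<open>'d\<close>; \<open>axis_index\<close> recovers the coordinate from the basis
    vector.\<close>
  define g where "g b = ?c (axis_index b)" for b :: "real ^ 'd"
  interpret product_sigma_finite "\<lambda>_ :: real ^ 'd. lborel :: real measure" ..
  have B: "Basis = range (\<lambda>i :: 'd. axis i (1::real))" by (auto simp: Basis_vec_def)
  have inj: "inj (\<lambda>i :: 'd. axis i (1::real))" by (auto simp: inj_on_def axis_eq_axis)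
  have prod_Basis: "(\<Prod>b\<in>Basis. h b) = (\<Prod>i\<in>UNIV. h (axis i 1))" for h :: "real ^ 'd \<Rightarrow> complex"
    unfolding B by (subst prod.reindex[OF inj]) simp
  have gi: "g (axis i 1) = ?c i" for i by (simp add: g_def axis_index_axis)
  have [measurable]: "(\<lambda>t. cis (c * t)) \<in> borel_measurable borel" for c
    by (intro borel_measurable_continuous_onI continuous_intros)
  have meas: "g b \<in> borel_measurable borel" for b
    unfolding g_def by measurable
  have int1: "integrable lborel (?c i)" for i
    using borel_integrable_compact[of "{0..1::real}" "\<lambda>t. cis (2 * pi * of_int (k $ i) * t)"]
    by (simp add: continuous_intros)
  have val: "integral\<^sup>L lborel (?c i) = (if k $ i = 0 then 1 else 0)" for i
  proof -
    have "integral\<^sup>L lborel (?c i) = integral\<^sup>L lebesgue (?c i)"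
      by (rule integral_completion[symmetric]) measurable
    also have "\<dots> = integral\<^sup>L (lebesgue_on {0..1}) (\<lambda>t. cis (2 * pi * of_int (k $ i) * t))"
      by (subst integral_restrict_space) auto
    finally show ?thesis by (simp add: integral_cis_unit)
  qed
  have eq: "indicator (cbox 0 One) x *\<^sub>R tchar k x = (\<Prod>b\<in>Basis. g b (x \<bullet> b))" for x
  proof -
    have "(\<Prod>b\<in>Basis. g b (x \<bullet> b)) = (\<Prod>i\<in>UNIV. ?c i (x $ i))"
      unfolding prod_Basis gi by (simp add: inner_axis)
    also have "\<dots> = (\<Prod>i\<in>UNIV. of_real (indicator {0..1} (x $ i))) * (\<Prod>i\<in>UNIV. cis (2 * pi * of_int (k $ i) * x $ i))"
      by (simp add: scaleR_conv_of_real prod.distrib)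
    also have "(\<Prod>i\<in>UNIV. cis (2 * pi * of_int (k $ i) * x $ i)) = tchar k x"
      unfolding tchar_def by (simp add: cis_conv_exp flip: exp_sum) (simp add: sum_distrib_left mult_ac)
    also have "(\<Prod>i\<in>UNIV. complex_of_real (indicator {0..1} (x $ i))) = of_real (indicator (cbox 0 One) x)"
    proof (cases "x \<in> cbox 0 One")
      case True
      then show ?thesis by (simp add: mem_unit_cube)
    next
      case False
      then obtain i where "\<not> (0 \<le> x $ i \<and> x $ i \<le> 1)" unfolding mem_unit_cube by blast
      then have "(\<Prod>i\<in>UNIV. complex_of_real (indicator {0..1} (x $ i))) = 0"
        by (intro prod_zero) (auto intro!: exI[of _ i] simp: indicator_def)
      then show ?thesis using False by simp
    qed
    finally show ?thesis by (simp add: scaleR_conv_of_real)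
  qed
  have "integral\<^sup>L tor_measure (tchar k) = integral\<^sup>L lebesgue (\<lambda>x. indicator (cbox 0 One) x *\<^sub>R tchar k x)"
    by (subst integral_restrict_space) auto
  also have "\<dots> = integral\<^sup>L lebesgue (\<lambda>x. \<Prod>b\<in>Basis. g b (x \<bullet> b))"
    by (simp only: eq)
  also have "\<dots> = integral\<^sup>L lborel (\<lambda>x. \<Prod>b\<in>Basis. g b (x \<bullet> b))"
    by (rule integral_completion) (use meas in measurable)
  also have "\<dots> = integral\<^sup>L (\<Pi>\<^sub>M b\<in>Basis. lborel) (\<lambda>f. \<Prod>b\<in>Basis. g b (f b))"
  proof (subst lborel_eq[where 'a = "real ^ 'd"], subst integral_distr)
    show "(\<lambda>f. \<Sum>b\<in>Basis. f b *\<^sub>R b) \<in> (\<Pi>\<^sub>M b\<in>Basis. lborel) \<rightarrow>\<^sub>M (borel :: (real ^ 'd) measure)"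
      by measurable
    show "(\<lambda>x :: real ^ 'd. \<Prod>b\<in>Basis. g b (x \<bullet> b)) \<in> borel_measurable borel"
      using meas by measurable
  qed (simp add: inner_sum_left_Basis cong: prod.cong)
  also have "\<dots> = (\<Prod>b\<in>Basis. integral\<^sup>L lborel (g b))"
    by (rule product_integral_prod) (auto simp: B gi int1)
  also have "\<dots> = (\<Prod>i\<in>UNIV. if k $ i = 0 then 1 else 0)"
    unfolding prod_Basis gi val ..
  also have "\<dots> = (if k = 0 then 1 else 0)"
    by (auto simp: vec_eq_iff)
  finally show ?thesis .
qed

text \<open>As the functions g are bounded by 1, the remainder after a finite set F is at most the
  tail of the sum of |c p|, uniformly in x. Over a finite measure this suffices along the net of
  finite sets, where dominated convergence for sequences does not apply directly. It serves both the
  cube and the curve.\<close>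

lemma has_sum_integral:
  fixes g :: "'p \<Rightarrow> 'a \<Rightarrow> complex"
  assumes fin: "finite_measure M" and f: "integrable M f" and g: "\<And>p. integrable M (g p)"
    and le: "\<And>p x. norm (g p x) \<le> 1"
    and sums: "\<And>x. ((\<lambda>p. c p * g p x) has_sum f x) UNIV"
    and c: "(\<lambda>p. norm (c p)) summable_on UNIV"
  shows "((\<lambda>p. c p * integral\<^sup>L M (g p)) has_sum integral\<^sup>L M f) UNIV"
proof -
  define S where "S = (\<Sum>\<^sub>\<infinity>p. norm (c p))"
  define m where "m = measure M (space M)"
  have tail: "norm (f x - (\<Sum>p\<in>F. c p * g p x)) \<le> S - (\<Sum>p\<in>F. norm (c p))" if F: "finite F" for F x
  proof (rule tendsto_upperbound)
    show "((\<lambda>G. norm ((\<Sum>p\<in>G. c p * g p x) - (\<Sum>p\<in>F. c p * g p x))) \<longlongrightarrow>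
        norm (f x - (\<Sum>p\<in>F. c p * g p x))) (finite_subsets_at_top UNIV)"
      using sums[of x] unfolding has_sum_def by (intro tendsto_intros)
    have "norm ((\<Sum>p\<in>G. c p * g p x) - (\<Sum>p\<in>F. c p * g p x)) \<le> S - (\<Sum>p\<in>F. norm (c p))"
      if G: "finite G" "F \<subseteq> G" for G
    proof -
      have "norm (\<Sum>p\<in>G - F. c p * g p x) \<le> (\<Sum>p\<in>G - F. norm (c p))"
        by (rule sum_norm_le) (use le in \<open>auto simp: norm_mult intro: mult_left_le\<close>)
      moreover have "(\<Sum>p\<in>G. norm (c p)) \<le> S"
        unfolding S_def by (rule finite_sum_le_infsum[OF c]) (use G in auto)
      ultimately show ?thesis using G F by (simp add: sum_diff)
    qed
    then show "\<forall>\<^sub>F G in finite_subsets_at_top UNIV.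
        norm ((\<Sum>p\<in>G. c p * g p x) - (\<Sum>p\<in>F. c p * g p x)) \<le> S - (\<Sum>p\<in>F. norm (c p))"
      unfolding eventually_finite_subsets_at_top using F by blast
  qed simp
  have diff: "norm (integral\<^sup>L M f - (\<Sum>p\<in>F. c p * integral\<^sup>L M (g p))) \<le> (S - (\<Sum>p\<in>F. norm (c p))) * m"
    if F: "finite F" for F
  proof -
    interpret finite_measure M by fact
    have i: "integrable M (\<lambda>x. f x - (\<Sum>p\<in>F. c p * g p x))"
      using f g by auto
    have "norm (integral\<^sup>L M f - (\<Sum>p\<in>F. c p * integral\<^sup>L M (g p)))
        = norm (integral\<^sup>L M (\<lambda>x. f x - (\<Sum>p\<in>F. c p * g p x)))"
      using f g by simp
    also have "\<dots> \<le> (\<integral>x. norm (f x - (\<Sum>p\<in>F. c p * g p x)) \<partial>M)"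
      by (rule integral_norm_bound)
    also have "\<dots> \<le> (\<integral>x. S - (\<Sum>p\<in>F. norm (c p)) \<partial>M)"
      by (intro integral_mono integrable_norm[OF i] integrable_const tail[OF F])
    finally show ?thesis by (simp add: m_def mult.commute)
  qed
  have "((\<lambda>F. \<Sum>p\<in>F. norm (c p)) \<longlongrightarrow> S) (finite_subsets_at_top UNIV)"
    using has_sum_infsum[OF c] by (simp add: has_sum_def S_def)
  then have "((\<lambda>F. (S - (\<Sum>p\<in>F. norm (c p))) * m) \<longlongrightarrow> (S - S) * m) (finite_subsets_at_top UNIV)"
    by (intro tendsto_intros)
  then have lim: "((\<lambda>F. (S - (\<Sum>p\<in>F. norm (c p))) * m) \<longlongrightarrow> 0) (finite_subsets_at_top UNIV)"
    by simp
  have "((\<lambda>F. integral\<^sup>L M f - (\<Sum>p\<in>F. c p * integral\<^sup>L M (g p))) \<longlongrightarrow> 0) (finite_subsets_at_top UNIV)"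
    by (rule Lim_null_comparison[OF _ lim], rule eventually_finite_subsets_at_top_weakI, rule diff)
  then have "((\<lambda>F. integral\<^sup>L M f - (integral\<^sup>L M f - (\<Sum>p\<in>F. c p * integral\<^sup>L M (g p)))) \<longlongrightarrow> integral\<^sup>L M f - 0)
      (finite_subsets_at_top UNIV)"
    by (intro tendsto_diff tendsto_const)
  then show ?thesis by (simp add: has_sum_def)
qed

section \<open>Density of trigonometric polynomials; uniqueness and inversion of Fourier
  series\<close>

inductive trig_poly :: "(real ^ 'd \<Rightarrow> complex) \<Rightarrow> bool" where
  tchar: "trig_poly (tchar k)"
| scale: "trig_poly f \<Longrightarrow> trig_poly (\<lambda>x. c * f x)"
| add: "trig_poly f \<Longrightarrow> trig_poly g \<Longrightarrow> trig_poly (\<lambda>x. f x + g x)"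

lemma trig_poly_const: "trig_poly (\<lambda>x. c)"
  using trig_poly.scale[OF trig_poly.tchar[of 0], of c] by simp

lemma trig_poly_mult:
  assumes "trig_poly f" "trig_poly g"
  shows "trig_poly (\<lambda>x. f x * g x)"
  using assms(1)
proof induction
  case (tchar k)
  show ?case using assms(2)
  proof induction
    case (tchar l)
    then show ?case using trig_poly.tchar[of "k + l"] by (simp add: tchar_add[abs_def])
  next
    case (scale f c)
    then show ?case using trig_poly.scale[OF scale.IH, of c] by (simp add: mult_ac)
  next
    case (add f g)
    then show ?case using trig_poly.add[OF add.IH] by (simp add: distrib_left)
  qed
next
  case (scale f c)
  then show ?case using trig_poly.scale[OF scale.IH, of c] by (simp add: mult_ac)
next
  case (add f g)
  then show ?case using trig_poly.add[OF add.IH] by (simp add: distrib_right)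
qed

lemma trig_poly_sum:
  assumes "\<And>b. b \<in> B \<Longrightarrow> trig_poly (h b)"
  shows "trig_poly (\<lambda>x. \<Sum>b\<in>B. h b x)"
proof (cases "finite B")
  case True
  then show ?thesis using assms
    by (induction B) (auto intro: trig_poly_const trig_poly.add)
qed (simp add: trig_poly_const)

lemma continuous_on_trig_poly: "trig_poly f \<Longrightarrow> continuous_on UNIV f"
  by (induction rule: trig_poly.induct) (auto intro: continuous_intros)

text \<open>Identifying the torus with a compact subset of C^d makes the Stone-Weierstrass theorem applicable.\<close>

definition circ :: "real ^ 'd \<Rightarrow> complex ^ 'd" where
  "circ x = (\<chi> i. cis (2 * pi * x $ i))"

lemma continuous_on_circ: "continuous_on A circ"
  unfolding circ_def by (intro continuous_intros)

lemma circ_eq_iff: "circ x = circ y \<longleftrightarrow> (\<exists>k. x = y + int_vec k)"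
proof
  assume "circ x = circ y"
  then have "cis (2 * pi * x $ i) = cis (2 * pi * y $ i)" for i
    by (simp add: circ_def vec_eq_iff)
  then have "\<exists>n::int. 2 * pi * x $ i = 2 * pi * y $ i + 2 * pi * n" for i
    by (intro iffD1[OF sin_cos_eq_iff]) (simp add: complex_eq_iff)
  then have "\<exists>n::int. x $ i = y $ i + n" for i
    by (simp flip: distrib_left)
  then obtain k where "\<And>i. x $ i = y $ i + of_int (k i)" by metis
  then show "\<exists>k. x = y + int_vec k"
    by (intro exI[of _ "\<chi> i. k i"]) (simp add: vec_eq_iff)
next
  assume "\<exists>k. x = y + int_vec k"
  then show "circ x = circ y"
    by (auto simp: circ_def vec_eq_iff distrib_left cis_multiple_2pi simp flip: cis_mult)
qed

lemma trig_poly_real_polynomial: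
  assumes "real_polynomial_function g"
  shows "trig_poly (\<lambda>x. complex_of_real (g (circ x)))"
  using assms
proof induction
  case (linear f)
  interpret bounded_linear f by fact
  have "trig_poly (\<lambda>x. complex_of_real (circ x \<bullet> b))" if b: "b \<in> Basis" for b :: "complex ^ 'd"
  proof -
    obtain i u where b: "b = axis i u" using b by (auto simp: Basis_vec_def)
    let ?k = "axis i 1 :: int ^ 'd"
    have k: "(\<Sum>j\<in>UNIV. of_int (?k $ j) * x $ j) = x $ i" for x :: "real ^ 'd"
      by (simp add: axis_def if_distrib[of of_int] if_distrib[of "\<lambda>y. y * _"] cong: if_cong)
    \<comment> \<open>The real inner product of z and u is the real part of
      \<open>cnj u * z\<close>, that is, half the sum of \<open>cnj u * z\<close> and its conjugate;
      for z a coordinate of \<open>circ x\<close> both are multiples of characters.\<close>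
    have "complex_of_real (circ x \<bullet> b) = cnj u / 2 * tchar ?k x + u / 2 * tchar (- ?k) x" for x
    proof -
      have t: "tchar ?k x = cis (2 * pi * x $ i)" "tchar (- ?k) x = cnj (cis (2 * pi * x $ i))"
        unfolding tchar_uminus_cnj unfolding tchar_def k by simp_all
      have "circ x \<bullet> b = cis (2 * pi * x $ i) \<bullet> u"
        by (simp add: b inner_axis circ_def)
      then show ?thesis
        unfolding t by (simp add: complex_eq_iff inner_complex_def field_simps)
    qed
    then show ?thesis
      by (simp only:) (intro trig_poly.intros)
  qed
  then have "trig_poly (\<lambda>x. \<Sum>b\<in>Basis. complex_of_real (f b) * complex_of_real (circ x \<bullet> b))"
    by (intro trig_poly_sum trig_poly.scale)
  moreover have *: "f y = (\<Sum>b\<in>Basis. f b * (y \<bullet> b))" for y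
  proof -
    have "f y = f (\<Sum>b\<in>Basis. (y \<bullet> b) *\<^sub>R b)" by (simp add: euclidean_representation)
    also have "\<dots> = (\<Sum>b\<in>Basis. f b * (y \<bullet> b))" by (simp add: sum scaleR mult.commute)
    finally show ?thesis .
  qed
  have "complex_of_real (f (circ x)) = (\<Sum>b\<in>Basis. complex_of_real (f b) * complex_of_real (circ x \<bullet> b))" for x
    by (subst *) simp
  ultimately show ?case by (simp only:)
next
  case (const c)
  show ?case by (rule trig_poly_const)
qed (simp_all add: trig_poly.add trig_poly_mult)

lemma trig_poly_dense:
  fixes h :: "real ^ 'd \<Rightarrow> real"
  assumes c: "continuous_on UNIV h" and per: "tor_periodic h" and e: "e > 0"
  shows "\<exists>p. trig_poly p \<and> (\<forall>x. norm (of_real (h x) - p x) < e)"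
proof -
  let ?Q = "cbox 0 One :: (real ^ 'd) set"
  define S where "S = circ ` ?Q"
  \<comment> \<open>h descends to the image of \<open>circ\<close>; the choice of a preimage is
    harmless, as preimages differ by integer vectors.\<close>
  define h' where "h' w = h (SOME x. circ x = w)" for w
  have h': "h' (circ x) = h x" for x
  proof -
    have "circ (SOME y. circ y = circ x) = circ x" by (rule someI) simp
    then obtain k where "(SOME y. circ y = circ x) = x + int_vec k" by (auto simp: circ_eq_iff)
    then show ?thesis using per by (simp add: h'_def tor_periodic_def)
  qed
  have S: "circ x \<in> S" for x
  proof -
    obtain k where "x + int_vec k \<in> ?Q" using translate_into_cube by blast
    moreover have "circ x = circ (x + int_vec k)" by (metis circ_eq_iff)
    ultimately show ?thesis unfolding S_def by blast
  qed
  have "compact S"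
    unfolding S_def by (intro compact_continuous_image continuous_on_circ compact_cbox)
  moreover have "continuous_on S h'"
    unfolding continuous_on_closed_vimage[OF compact_imp_closed[OF \<open>compact S\<close>]]
  proof safe
    fix B :: "real set" assume B: "closed B"
    \<comment> \<open>Continuity is transported through \<open>circ\<close> by closed sets: the cube
      is compact, so the images of its closed subsets are compact.\<close>
    have "h' -` B \<inter> S = circ ` (?Q \<inter> h -` B)"
      by (auto simp: S_def h')
    moreover have "compact (?Q \<inter> h -` B)"
      by (intro compact_Int_closed compact_cbox continuous_closed_vimage B)
        (use c in \<open>simp add: continuous_on_eq_continuous_at\<close>)
    ultimately show "closed (h' -` B \<inter> S)"
      by (metis compact_continuous_image continuous_on_circ compact_imp_closed)
  qed
  ultimately obtain g where g: "real_polynomial_function g" "\<And>w. w \<in> S \<Longrightarrow> \<bar>h' w - g w\<bar> < e"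
    using Stone_Weierstrass_real_polynomial_function e by metis
  have "norm (of_real (h x) - complex_of_real (g (circ x))) < e" for x
    using g(2)[OF S[of x]] by (simp add: h' flip: of_real_diff)
  then show ?thesis using trig_poly_real_polynomial[OF g(1)] by blast
qed

text \<open>The integral of H r vanishes for every trigonometric polynomial r, so the integral of
  |H|^2 equals that of \<open>H * (cnj H - r)\<close>, which is small once r approximates
  \<open>cnj H\<close> uniformly.\<close>

lemma fourier_unique:
  fixes H :: "real ^ 'd \<Rightarrow> complex"
  assumes c: "continuous_on UNIV H" and per: "tor_periodic H"
    and z: "\<And>k. integral\<^sup>L tor_measure (\<lambda>x. H x * tchar k x) = 0"
  shows "H x = 0"
proof -
  let ?I = "integral\<^sup>L (tor_measure :: (real ^ 'd) measure)"
  have zp: "?I (\<lambda>x. H x * p x) = 0" if "trig_poly p" for p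
    using that
  proof induction
    case (scale f c)
    have "?I (\<lambda>x. H x * (c * f x)) = ?I (\<lambda>x. c * (H x * f x))" by (simp add: mult_ac)
    also have "\<dots> = 0" using scale by simp
    finally show ?case .
  next
    case (add f g)
    have i: "integrable tor_measure (\<lambda>x. H x * f x)" "integrable tor_measure (\<lambda>x. H x * g x)"
      by (intro integrable_continuous_tor continuous_on_mult continuous_on_trig_poly c add.hyps)+
    then show ?case using add by (simp add: distrib_left)
  qed (rule z)
  obtain B where B: "B > 0" "\<And>x. norm (H x) \<le> B" using torus_bounded[OF c per] by blast
  have cn: "continuous_on UNIV (\<lambda>x. (norm (H x))\<^sup>2)" by (intro continuous_intros c)
  interpret finite_measure "tor_measure :: (real ^ 'd) measure" by (rule finite_measure_tor)
  have "?I (\<lambda>x. (norm (H x))\<^sup>2) \<le> 0 + e" if e: "e > 0" for e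
  proof -
    \<comment> \<open>Density is available for real-valued functions, so real and imaginary parts
      are approximated separately, each within e'; the total error 2 e' gets multiplied by the bound
      B of |H|.\<close>
    define e' where "e' = e / (2 * B)"
    have e': "e' > 0" using e B by (simp add: e'_def)
    obtain p where p: "trig_poly p" "\<And>x. norm (of_real (Re (H x)) - p x) < e'"
      using trig_poly_dense[of "\<lambda>x. Re (H x)" e'] c per e'
      by (auto intro: continuous_intros simp: tor_periodic_def)
    obtain q where q: "trig_poly q" "\<And>x. norm (of_real (Im (H x)) - q x) < e'"
      using trig_poly_dense[of "\<lambda>x. Im (H x)" e'] c per e'
      by (auto intro: continuous_intros simp: tor_periodic_def)
    define r where "r x = p x + (- \<i>) * q x" for x
    have r: "trig_poly r" unfolding r_def by (intro trig_poly.intros p q)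
    have rle: "norm (cnj (H x) - r x) \<le> 2 * e'" for x
    proof -
      have "cnj (H x) - r x = (of_real (Re (H x)) - p x) - \<i> * (of_real (Im (H x)) - q x)"
        by (simp add: r_def complex_eq_iff)
      also have "norm \<dots> \<le> norm (of_real (Re (H x)) - p x) + norm (\<i> * (of_real (Im (H x)) - q x))"
        by (rule norm_triangle_ineq4)
      also have "\<dots> \<le> 2 * e'" using p(2)[of x] q(2)[of x] by (simp add: norm_mult)
      finally show ?thesis .
    qed
    have i1: "integrable tor_measure (\<lambda>x. H x * cnj (H x))" and i2: "integrable tor_measure (\<lambda>x. H x * r x)"
      by (intro integrable_continuous_tor continuous_intros continuous_on_trig_poly[OF r] c)+
    have "complex_of_real (?I (\<lambda>x. (norm (H x))\<^sup>2)) = ?I (\<lambda>x. H x * cnj (H x))"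
      by (simp only: complex_norm_square integral_complex_of_real[symmetric])
    also have "\<dots> = ?I (\<lambda>x. H x * cnj (H x) - H x * r x)"
      using i1 i2 zp[OF r] by simp
    finally have "norm (complex_of_real (?I (\<lambda>x. (norm (H x))\<^sup>2))) = norm (?I (\<lambda>x. H x * cnj (H x) - H x * r x))"
      by simp
    also have "\<dots> \<le> ?I (\<lambda>x. norm (H x * cnj (H x) - H x * r x))"
      by (rule integral_norm_bound)
    also have "\<dots> \<le> ?I (\<lambda>x. B * (2 * e'))"
    proof (rule integral_mono)
      fix x
      show "norm (H x * cnj (H x) - H x * r x) \<le> B * (2 * e')"
        unfolding right_diff_distrib[symmetric] norm_mult
        using B rle[of x] by (intro mult_mono) auto
    qed (use i1 i2 in auto)
    also have "\<dots> = e" using B by (simp add: e'_def)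
    finally show ?thesis by simp
  qed
  then have "?I (\<lambda>x. (norm (H x))\<^sup>2) \<le> 0" by (rule field_le_epsilon)
  moreover have "?I (\<lambda>x. (norm (H x))\<^sup>2) \<ge> 0" by (rule integral_nonneg_AE) simp
  ultimately have "?I (\<lambda>x. (norm (H x))\<^sup>2) = 0" by simp
  then have "AE x in tor_measure. (norm (H x))\<^sup>2 = 0"
    using integrable_continuous_tor[OF cn] by (subst (asm) integral_nonneg_eq_0_iff_AE) auto
  then have "AE x in tor_measure. H x = 0" by simp
  then show ?thesis using continuous_AE_zero[OF c per] by blast
qed

text \<open>The sum G of the series is continuous by the M-test and has the same Fourier
  coefficients as f, so uniqueness gives G = f at every point.\<close>

lemma fourier_series:
  fixes f :: "real ^ 'd \<Rightarrow> real"
  assumes c: "continuous_on UNIV f" and per: "tor_periodic f"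
    and abs: "(\<lambda>k. norm (fourier_coeff f k)) summable_on UNIV"
  shows "((\<lambda>k. fourier_coeff f k * tchar k x) has_sum of_real (f x)) UNIV"
proof -
  define a where "a = fourier_coeff f"
  define G where "G x = (\<Sum>\<^sub>\<infinity>k. a k * tchar k x)" for x
  have abs: "(\<lambda>k. norm (a k)) summable_on UNIV" using abs by (simp add: a_def)
  have sums: "((\<lambda>k. a k * tchar k x) has_sum G x) UNIV" for x
  proof -
    have "(\<lambda>k. norm (a k * tchar k x)) summable_on UNIV" using abs by (simp add: norm_mult)
    then show ?thesis unfolding G_def by (rule has_sum_infsum[OF abs_summable_summable])
  qed
  have "uniform_limit UNIV (\<lambda>F x. \<Sum>k\<in>F. a k * tchar k x) G (finite_subsets_at_top UNIV)"
    unfolding G_def[abs_def] by (rule Weierstrass_m_test_general[OF _ abs]) (simp add: norm_mult)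
  then have cG: "continuous_on UNIV G"
    by (intro uniform_limit_theorem[where F = "finite_subsets_at_top UNIV"])
      (auto intro!: always_eventually continuous_intros)
  have pG: "tor_periodic G"
    by (simp add: tor_periodic_def G_def tor_periodic_tchar[unfolded tor_periodic_def, rule_format])
  have "of_real (f x) - G x = 0"
  proof (rule fourier_unique)
    show "continuous_on UNIV (\<lambda>x. of_real (f x) - G x)" by (intro continuous_intros c cG)
    show "tor_periodic (\<lambda>x. of_real (f x) - G x)" using per pG by (simp add: tor_periodic_def)
    fix k
    let ?I = "integral\<^sup>L (tor_measure :: (real ^ 'd) measure)"
    have "((\<lambda>p. a p * ?I (tchar (p + k))) has_sum ?I (\<lambda>x. G x * tchar k x)) UNIV"
    proof (rule has_sum_integral)
      show "((\<lambda>p. a p * tchar (p + k) x) has_sum G x * tchar k x) UNIV" for x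
        using has_sum_cmult_left[OF sums[of x], of "tchar k x"] by (simp add: tchar_add mult_ac)
    qed (auto intro!: integrable_continuous_tor continuous_intros finite_measure_tor cG abs)
    then have "((\<lambda>p. if p = - k then a p else 0) has_sum ?I (\<lambda>x. G x * tchar k x)) UNIV"
      by (rule has_sum_cong[THEN iffD1, rotated]) (auto simp: integral_tchar add_eq_0_iff2)
    moreover have "((\<lambda>p. if p = - k then a p else 0) has_sum a (- k)) UNIV"
      by (rule has_sum_finite_neutralI[of "{- k}"]) auto
    ultimately have "?I (\<lambda>x. G x * tchar k x) = a (- k)"
      using has_sum_unique by blast
    moreover have "?I (\<lambda>x. of_real (f x) * tchar k x) = a (- k)"
      by (simp add: a_def fourier_coeff_tchar)
    moreover have "integrable tor_measure (\<lambda>x. of_real (f x) * tchar k x)" "integrable tor_measure (\<lambda>x. G x * tchar k x)"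
      by (intro integrable_continuous_tor continuous_intros c cG)+
    ultimately show "?I (\<lambda>x. (of_real (f x) - G x) * tchar k x) = 0"
      by (simp add: left_diff_distrib)
  qed
  then show ?thesis using sums[of x] by (simp add: a_def)
qed

subsection \<open>Lattice sums\<close>

text \<open>For nonzero j the terms at j and - j are each at most |j|^(-2p), and 2p > 1.\<close>

lemma sum_int_powr_bounded:
  fixes p :: real
  assumes "p > 1 / 2"
  shows "\<exists>S. \<forall>n::nat. (\<Sum>j\<in>{- int n..int n}. (1 + (of_int j)\<^sup>2) powr - p) \<le> S"
proof -
  let ?h = "\<lambda>j::int. (1 + (of_int j)\<^sup>2 :: real) powr - p"
  let ?u = "\<lambda>m. real (Suc m) powr (- 2 * p)"
  have "summable (\<lambda>m. real m powr (- 2 * p))"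
    using assms by (subst summable_real_powr_iff) auto
  then have su: "summable ?u" by (subst summable_Suc_iff)
  have hu: "?h j \<le> ?u m" if "\<bar>j\<bar> = int (Suc m)" for j m
  proof -
    have "real_of_int \<bar>j\<bar> = real (Suc m)" using that by simp
    then have "(of_int j)\<^sup>2 = (real (Suc m))\<^sup>2" by (metis of_int_abs power2_abs)
    then have "?h j \<le> ((real (Suc m))\<^sup>2) powr - p"
      using assms by (intro powr_mono2') auto
    also have "\<dots> = ?u m"
      by (simp add: powr_powr flip: powr_numeral)
    finally show ?thesis .
  qed
  have "(\<Sum>j\<in>{- int n..int n}. ?h j) \<le> 1 + 2 * (\<Sum>m<n. ?u m)" for n
  proof (induction n)
    case (Suc n)
    have "{- int (Suc n)..int (Suc n)} = insert (- int (Suc n)) (insert (int (Suc n)) {- int n..int n})"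
      by auto
    then have "(\<Sum>j\<in>{- int (Suc n)..int (Suc n)}. ?h j)
        = ?h (- int (Suc n)) + (?h (int (Suc n)) + (\<Sum>j\<in>{- int n..int n}. ?h j))"
      by simp
    then show ?case
      using Suc hu[of "- int (Suc n)" n] hu[of "int (Suc n)" n] by (simp del: of_nat_Suc)
  qed simp
  moreover have "(\<Sum>m<n. ?u m) \<le> suminf ?u" for n
    by (rule sum_le_suminf[OF su]) auto
  ultimately show ?thesis
    by (intro exI[of _ "1 + 2 * suminf ?u"] allI) (meson add_left_mono mult_left_mono order_trans zero_le_numeral)
qed

definition sqnorm :: "int ^ 'd \<Rightarrow> real" where
  "sqnorm k = (\<Sum>i\<in>UNIV. (of_int (k $ i))\<^sup>2)"

lemma sqnorm_nonneg: "sqnorm k \<ge> 0"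
  by (simp add: sqnorm_def sum_nonneg)

lemma component_le_sqnorm: "(of_int (k $ i))\<^sup>2 \<le> sqnorm k"
  unfolding sqnorm_def by (rule member_le_sum) auto

text \<open>The exponent is split evenly among the d coordinates: (1 + |k|^2)^(-s/d) is at most (1 +
  k_i^2)^(-s/d) for each i. The sum over a box then becomes the d-th power of a one-dimensional sum,
  bounded since 2s/d > 1.\<close>

lemma lattice_sum_bounded:
  assumes s: "s > real CARD('d) / 2"
  shows "\<exists>C>0. \<forall>F :: (int ^ 'd) set. finite F \<longrightarrow> (\<Sum>k\<in>F. (1 + sqnorm k) powr - s) \<le> C"
proof -
  define d where "d = real CARD('d)"
  have d: "d > 0" by (simp add: d_def)
  define p where "p = s / d"
  have p: "p > 1 / 2" using s d by (simp add: p_def d_def field_simps)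
  obtain S where S: "\<And>n::nat. (\<Sum>j\<in>{- int n..int n}. (1 + (of_int j)\<^sup>2) powr - p) \<le> S"
    using sum_int_powr_bounded[OF p] by blast
  let ?h = "\<lambda>j::int. (1 + (of_int j)\<^sup>2 :: real) powr - p"
  have le: "(1 + sqnorm k) powr - s \<le> (\<Prod>i\<in>UNIV. ?h (k $ i))" for k :: "int ^ 'd"
  proof -
    have "(1 + sqnorm k) powr - s = (\<Prod>i\<in>(UNIV :: 'd set). (1 + sqnorm k) powr - p)"
      using d sqnorm_nonneg[of k] by (simp add: p_def d_def powr_powr flip: powr_realpow')
    also have "\<dots> \<le> (\<Prod>i\<in>UNIV. ?h (k $ i))"
      using p component_le_sqnorm[of k]
      by (intro prod_mono conjI powr_mono2') (auto simp: add_pos_nonneg)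
    finally show ?thesis .
  qed
  have "(\<Sum>k\<in>F. (1 + sqnorm k) powr - s) \<le> max 1 (S ^ CARD('d))" if F: "finite F" for F :: "(int ^ 'd) set"
  proof -
    \<comment> \<open>A crude half-width of a box containing F; the bound S is independent of
      it.\<close>
    define n where "n = (\<Sum>k\<in>F. \<Sum>i\<in>UNIV. nat \<bar>k $ i\<bar>)"
    have n: "\<bar>k $ i\<bar> \<le> int n" if "k \<in> F" for k i
    proof -
      have "nat \<bar>k $ i\<bar> \<le> (\<Sum>i\<in>UNIV. nat \<bar>k $ i\<bar>)" by (rule member_le_sum) auto
      also have "\<dots> \<le> n" unfolding n_def using F that by (intro member_le_sum) auto
      finally show ?thesis by linarith
    qed
    let ?P = "PiE UNIV (\<lambda>_ :: 'd. {- int n..int n})"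
    have inj: "inj_on vec_nth F" by (auto simp: inj_on_def vec_nth_inject)
    have "(\<Sum>k\<in>F. (1 + sqnorm k) powr - s) \<le> (\<Sum>k\<in>F. \<Prod>i\<in>UNIV. ?h (k $ i))"
      by (intro sum_mono le)
    also have "\<dots> = (\<Sum>g\<in>vec_nth ` F. \<Prod>i\<in>UNIV. ?h (g i))"
      by (simp add: sum.reindex[OF inj])
    also have "\<dots> \<le> (\<Sum>g\<in>?P. \<Prod>i\<in>UNIV. ?h (g i))"
    proof (rule sum_mono2)
      show "finite ?P" by (intro finite_PiE) auto
      show "vec_nth ` F \<subseteq> ?P" using n by (auto simp: PiE_def Pi_def abs_le_iff) (smt (verit) n)+
    qed (auto intro: prod_nonneg)
    also have "\<dots> = (\<Prod>i\<in>(UNIV :: 'd set). \<Sum>j\<in>{- int n..int n}. ?h j)"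
      by (subst prod_sum_PiE) auto
    also have "\<dots> \<le> (\<Prod>i\<in>(UNIV :: 'd set). S)"
      using S by (intro prod_mono) (auto intro: sum_nonneg)
    finally show ?thesis by simp
  qed
  then show ?thesis by (intro exI[of _ "max 1 (S ^ CARD('d))"]) auto
qed

lemma sob_weight_sqnorm: "sob_weight s k = (1 + 4 * pi\<^sup>2 * sqnorm k) powr s"
  by (simp add: sob_weight_def sqnorm_def)

lemma weight_base_pos: "1 + 4 * pi\<^sup>2 * sqnorm k > 0"
  using sqnorm_nonneg[of k] by (simp add: add_pos_nonneg)

lemma sob_weight_pos [simp]: "sob_weight s k > 0"
  using weight_base_pos[of k] by (simp add: sob_weight_sqnorm)

lemma sqnorm_le_weight: "sqnorm k \<le> 4 * pi\<^sup>2 * sqnorm k"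
proof -
  have "1 \<le> pi\<^sup>2" using pi_ge_two by (simp add: one_le_power)
  then have "1 * sqnorm k \<le> (4 * pi\<^sup>2) * sqnorm k"
    using sqnorm_nonneg by (intro mult_right_mono) auto
  then show ?thesis by simp
qed

lemma inverse_sob_weight_le:
  assumes "s > 0" "c > 0" "0 < x" "x \<le> c * (1 + 4 * pi\<^sup>2 * sqnorm k)"
  shows "inverse (sob_weight s k) \<le> c powr s * x powr - s"
proof -
  have "inverse (sob_weight s k) = (1 + 4 * pi\<^sup>2 * sqnorm k) powr - s"
    by (simp add: sob_weight_sqnorm powr_minus)
  also have "\<dots> \<le> (x / c) powr - s"
    using assms by (intro powr_mono2') (auto simp: field_simps)
  also have "\<dots> = c powr s * x powr - s"
    using assms by (simp add: powr_divide powr_minus field_simps)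
  finally show ?thesis .
qed

lemma inverse_sob_weight_bounded:
  assumes s: "s > real CARD('d) / 2"
  shows "\<exists>C>0. \<forall>F :: (int ^ 'd) set. finite F \<longrightarrow> (\<Sum>k\<in>F. inverse (sob_weight s k)) \<le> C"
proof -
  have s0: "s > 0" using s by (smt (verit) of_nat_0_le_iff divide_nonneg_pos)
  obtain C where C: "C > 0" "\<And>F :: (int ^ 'd) set. finite F \<Longrightarrow> (\<Sum>k\<in>F. (1 + sqnorm k) powr - s) \<le> C"
    using lattice_sum_bounded[OF s] by blast
  have "inverse (sob_weight s k) \<le> (1 + sqnorm k) powr - s" for k :: "int ^ 'd"
    using inverse_sob_weight_le[of s 1 "1 + sqnorm k" k] s0 sqnorm_nonneg[of k] sqnorm_le_weight[of k]
    by (simp add: add_pos_nonneg)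
  then have "(\<Sum>k\<in>F. inverse (sob_weight s k)) \<le> (\<Sum>k\<in>F. (1 + sqnorm k) powr - s)" for F :: "(int ^ 'd) set"
    by (intro sum_mono)
  with C show ?thesis by (meson order_trans)
qed

text \<open>Componentwise division by N, rounding down, is injective on an N-separated set; this reduces the
  sum to the whole lattice and gains the factor N^(-2s).\<close>

lemma separated_sum_bounded:
  assumes s: "s > real CARD('d) / 2"
  shows "\<exists>C>0. \<forall>(N::nat) (G :: (int ^ 'd) set) F. N \<ge> 1 \<longrightarrow> finite F \<longrightarrow> F \<subseteq> G \<longrightarrow>
    (\<forall>k\<in>G. \<exists>i. int N \<le> \<bar>k $ i\<bar>) \<longrightarrow> (\<forall>k\<in>G. \<forall>l\<in>G. k \<noteq> l \<longrightarrow> (\<exists>i. int N \<le> \<bar>k $ i - l $ i\<bar>)) \<longrightarrow>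
    (\<Sum>k\<in>F. inverse (sob_weight s k)) \<le> C * real N powr (- 2 * s)"
proof -
  have s0: "s > 0" using s by (smt (verit) of_nat_0_le_iff divide_nonneg_pos)
  obtain C where C: "C > 0" "\<And>F :: (int ^ 'd) set. finite F \<Longrightarrow> (\<Sum>k\<in>F. (1 + sqnorm k) powr - s) \<le> C"
    using lattice_sum_bounded[OF s] by blast
  \<comment> \<open>The estimate below gives N^2 (1 + |q k|^2) \<le> 2 |k|^2 + (2d + 1) N^2, and N^2
    \<le> |k|^2 turns the right-hand side into (2d + 3) |k|^2.\<close>
  define c where "c = 2 * real CARD('d) + 3"
  have c: "c > 0" by (simp add: c_def add_nonneg_pos)
  have "(\<Sum>k\<in>F. inverse (sob_weight s k)) \<le> (c powr s * C) * real N powr (- 2 * s)"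
    if N: "N \<ge> 1" and F: "finite F" "F \<subseteq> G" and big: "\<And>k. k \<in> G \<Longrightarrow> \<exists>i. int N \<le> \<bar>k $ i\<bar>"
      and sep: "\<And>k l. k \<in> G \<Longrightarrow> l \<in> G \<Longrightarrow> k \<noteq> l \<Longrightarrow> \<exists>i. int N \<le> \<bar>k $ i - l $ i\<bar>"
    for N :: nat and G F :: "(int ^ 'd) set"
  proof -
    define q where "q k = (\<chi> i. k $ i div int N)" for k :: "int ^ 'd"
    have inj: "inj_on q F"
    proof (rule inj_onI, rule ccontr)
      fix k l assume kl: "k \<in> F" "l \<in> F" "q k = q l" "k \<noteq> l"
      then obtain i where i: "int N \<le> \<bar>k $ i - l $ i\<bar>" using sep F(2) by blast
      have "k $ i div int N = l $ i div int N" using kl(3) by (simp add: q_def vec_eq_iff)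
      then have "k $ i - l $ i = k $ i mod int N - l $ i mod int N"
        by (metis add_diff_cancel_left mult_div_mod_eq)
      moreover have "0 \<le> k $ i mod int N" "k $ i mod int N < int N" "0 \<le> l $ i mod int N" "l $ i mod int N < int N"
        using N by auto
      ultimately show False using i by linarith
    qed
    have le: "inverse (sob_weight s k) \<le> c powr s * real N powr (- 2 * s) * (1 + sqnorm (q k)) powr - s"
      if k: "k \<in> F" for k
    proof -
      have comp: "(real N * of_int (q k $ i))\<^sup>2 \<le> 2 * (of_int (k $ i))\<^sup>2 + 2 * (real N)\<^sup>2" for i
      proof -
        define r where "r = real_of_int (k $ i mod int N)"
        have "k $ i mod int N \<le> int N" by (intro less_imp_le pos_mod_bound) (use N in simp)
        then have "real_of_int (k $ i mod int N) \<le> real_of_int (int N)" by (simp only: of_int_le_iff)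
        then have r: "0 \<le> r" "r \<le> real N"
          using N by (simp_all add: r_def)
        have e: "real N * of_int (q k $ i) = of_int (k $ i) - r"
        proof -
          have "int N * (k $ i div int N) = k $ i - k $ i mod int N"
            by (simp add: minus_mod_eq_mult_div)
          then have "real_of_int (int N * (k $ i div int N)) = real_of_int (k $ i - k $ i mod int N)"
            by (rule arg_cong)
          then show ?thesis by (simp only: q_def r_def vec_lambda_beta of_int_mult of_int_diff of_int_of_nat_eq)
        qed
        have "(of_int (k $ i) - r)\<^sup>2 \<le> 2 * (of_int (k $ i))\<^sup>2 + 2 * r\<^sup>2"
          using zero_le_power2[of "of_int (k $ i) + r"] unfolding power2_sum power2_diff by linarith
        also have "\<dots> \<le> 2 * (of_int (k $ i))\<^sup>2 + 2 * (real N)\<^sup>2"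
          using power_mono[OF r(2) r(1), of 2] by simp
        finally show ?thesis unfolding e .
      qed
      have "(real N)\<^sup>2 * sqnorm (q k) = (\<Sum>i\<in>UNIV. (real N * of_int (q k $ i))\<^sup>2)"
        by (simp add: sqnorm_def sum_distrib_left power_mult_distrib)
      also have "\<dots> \<le> (\<Sum>i\<in>UNIV. 2 * (of_int (k $ i))\<^sup>2 + 2 * (real N)\<^sup>2)"
        by (rule sum_mono) (rule comp)
      also have "\<dots> = 2 * sqnorm k + 2 * real CARD('d) * (real N)\<^sup>2"
        by (simp add: sum.distrib sqnorm_def sum_distrib_left)
      finally have A: "(real N)\<^sup>2 * sqnorm (q k) \<le> 2 * sqnorm k + 2 * real CARD('d) * (real N)\<^sup>2" .
      \<comment> \<open>Only here the lower bound on the points themselves enters: without it a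
        point close to 0, with quotient 0, would not gain the factor N^(-2s).\<close>
      obtain i where i: "int N \<le> \<bar>k $ i\<bar>" using big k F(2) by blast
      have "real_of_int (int N) \<le> real_of_int \<bar>k $ i\<bar>" using i by (simp only: of_int_le_iff)
      then have "(real N)\<^sup>2 \<le> (of_int \<bar>k $ i\<bar>)\<^sup>2" by (intro power_mono) simp_all
      then have B: "(real N)\<^sup>2 \<le> sqnorm k" using component_le_sqnorm[of k i] by simp
      have "(real N)\<^sup>2 * (1 + sqnorm (q k)) \<le> 2 * sqnorm k + (2 * real CARD('d) + 1) * (real N)\<^sup>2"
        using A by (simp add: algebra_simps)
      also have "\<dots> \<le> 2 * sqnorm k + (2 * real CARD('d) + 1) * sqnorm k"
        by (intro add_left_mono mult_left_mono B) auto
      also have "\<dots> = c * sqnorm k" by (simp add: c_def algebra_simps)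
      also have "\<dots> \<le> c * (1 + 4 * pi\<^sup>2 * sqnorm k)"
        using sqnorm_le_weight[of k] c by (intro mult_left_mono) auto
      finally have "inverse (sob_weight s k) \<le> c powr s * ((real N)\<^sup>2 * (1 + sqnorm (q k))) powr - s"
        using s0 c N sqnorm_nonneg[of "q k"] by (intro inverse_sob_weight_le) (auto simp: add_pos_nonneg)
      also have "\<dots> = c powr s * real N powr (- 2 * s) * (1 + sqnorm (q k)) powr - s"
        using N sqnorm_nonneg[of "q k"] by (simp add: powr_mult powr_powr flip: powr_numeral)
      finally show ?thesis .
    qed
    have "(\<Sum>k\<in>F. inverse (sob_weight s k))
        \<le> (\<Sum>k\<in>F. c powr s * real N powr (- 2 * s) * (1 + sqnorm (q k)) powr - s)"
      by (intro sum_mono le)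
    also have "\<dots> = c powr s * real N powr (- 2 * s) * (\<Sum>k\<in>q ` F. (1 + sqnorm k) powr - s)"
      by (simp add: sum_distrib_left sum.reindex[OF inj])
    also have "\<dots> \<le> c powr s * real N powr (- 2 * s) * C"
      using C(2)[of "q ` F"] F(1) by (intro mult_left_mono) auto
    finally show ?thesis by (simp add: mult_ac)
  qed
  then show ?thesis
    using C(1) c by (intro exI[of _ "c powr s * C"]) auto
qed

section \<open>Weighted convolution estimate\<close>

lemma sob_weight_half_square: "(sob_weight (s / 2) k)\<^sup>2 = sob_weight s k"
  using weight_base_pos[of k] by (simp add: sob_weight_sqnorm power2_eq_square flip: powr_add)

text \<open>The base 1 + 4 pi^2 |j + l|^2 is at most four times the larger of its values at j and l.
  Dividing by the weight at j + l lets either factor of a product carry the smoothness.\<close>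

lemma sob_weight_add_le:
  assumes s: "s > 0"
  shows "sob_weight s (j + l) \<le> 4 powr s * (sob_weight s j + sob_weight s l)"
proof -
  let ?X = "\<lambda>k :: int ^ 'a. 1 + 4 * pi\<^sup>2 * sqnorm k"
  have "sqnorm (j + l) \<le> 2 * sqnorm j + 2 * sqnorm l"
  proof -
    have "(a + b)\<^sup>2 \<le> 2 * a\<^sup>2 + 2 * b\<^sup>2" for a b :: real
      using zero_le_power2[of "a - b"] unfolding power2_sum power2_diff by linarith
    then have "sqnorm (j + l) \<le> (\<Sum>i\<in>UNIV. 2 * (of_int (j $ i))\<^sup>2 + 2 * (of_int (l $ i))\<^sup>2)"
      unfolding sqnorm_def by (intro sum_mono) simp
    then show ?thesis by (simp add: sqnorm_def sum.distrib sum_distrib_left)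
  qed
  then have "4 * pi\<^sup>2 * sqnorm (j + l) \<le> 4 * pi\<^sup>2 * (2 * sqnorm j + 2 * sqnorm l)"
    by (intro mult_left_mono) auto
  also have "\<dots> = 2 * (4 * pi\<^sup>2 * sqnorm j) + 2 * (4 * pi\<^sup>2 * sqnorm l)"
    by (simp add: algebra_simps)
  finally have "?X (j + l) \<le> 2 * ?X j + 2 * ?X l" by simp
  moreover have "2 * x + 2 * y \<le> 4 * max x y" for x y :: real by (simp add: max_def)
  ultimately have "?X (j + l) \<le> 4 * max (?X j) (?X l)" by (rule order_trans)
  then have "sob_weight s (j + l) \<le> (4 * max (?X j) (?X l)) powr s"
    unfolding sob_weight_sqnorm using s weight_base_pos[of "j + l"] by (intro powr_mono2) auto
  also have "\<dots> = 4 powr s * max (?X j) (?X l) powr s"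
    using weight_base_pos[of j] by (intro powr_mult)
  also have "max (?X j) (?X l) powr s \<le> sob_weight s j + sob_weight s l"
    unfolding sob_weight_sqnorm by (simp add: max_def)
  finally show ?thesis by simp
qed

text \<open>A Young-type bound: absolute summability in l times a uniform bound on the fibres in j.
  \<open>prod.swap\<close> makes l the outer index.\<close>

lemma sum_pairs_le:
  fixes b :: "'b \<Rightarrow> real"
  assumes F: "finite F" and b: "\<And>l. b l \<ge> 0" "\<And>E. finite E \<Longrightarrow> (\<Sum>l\<in>E. b l) \<le> P" and D: "D \<ge> 0"
    and h: "\<And>l. (\<Sum>j\<in>{j. (j, l) \<in> F}. h j l) \<le> D"
  shows "(\<Sum>(j, l)\<in>F. b l * h j l) \<le> P * D"
proof -
  have fin: "finite {j. (j, l) \<in> F}" for l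
    by (rule finite_subset[of _ "fst ` F"]) (use F in force)+
  have "(\<Sum>(j, l)\<in>F. b l * h j l) = (\<Sum>(l, j)\<in>prod.swap ` F. b l * h j l)"
    by (subst sum.reindex) (auto simp: case_prod_unfold)
  also have "prod.swap ` F = (SIGMA l:snd ` F. {j. (j, l) \<in> F})" by force
  also have "(\<Sum>(l, j)\<in>(SIGMA l:snd ` F. {j. (j, l) \<in> F}). b l * h j l)
      = (\<Sum>l\<in>snd ` F. \<Sum>j\<in>{j. (j, l) \<in> F}. b l * h j l)"
    using F fin by (subst sum.Sigma) auto
  also have "\<dots> = (\<Sum>l\<in>snd ` F. b l * (\<Sum>j\<in>{j. (j, l) \<in> F}. h j l))"
    by (simp add: sum_distrib_left)
  also have "\<dots> \<le> (\<Sum>l\<in>snd ` F. b l * D)"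
    by (intro sum_mono mult_left_mono h b)
  also have "\<dots> \<le> P * D"
    using b(2)[of "snd ` F"] F D by (simp add: mult_right_mono flip: sum_distrib_right)
  finally show ?thesis .
qed

text \<open>Once the weight of exponent s/2 has moved to one factor, that factor and 1/w(j + l) are
  controlled by sums of squares, the other factor by its absolute sum. For fixed l the shift j -> j
  + l embeds a fibre of F into G, so the tail bound holds uniformly in l.\<close>

lemma convolution_tail:
  fixes a b :: "int ^ 'd \<Rightarrow> real"
  assumes s: "s > 0" and N: "N > 0" and C: "C \<ge> 0" "Ma \<ge> 0" "Mb \<ge> 0"
    and a: "\<And>k. a k \<ge> 0" "\<And>E. finite E \<Longrightarrow> (\<Sum>k\<in>E. a k) \<le> Pa"
      "\<And>E. finite E \<Longrightarrow> (\<Sum>k\<in>E. sob_weight s k * (a k)\<^sup>2) \<le> Ma"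
    and b: "\<And>k. b k \<ge> 0" "\<And>E. finite E \<Longrightarrow> (\<Sum>k\<in>E. b k) \<le> Pb"
      "\<And>E. finite E \<Longrightarrow> (\<Sum>k\<in>E. sob_weight s k * (b k)\<^sup>2) \<le> Mb"
    and G: "\<And>E. finite E \<Longrightarrow> E \<subseteq> G \<Longrightarrow> (\<Sum>k\<in>E. inverse (sob_weight s k)) \<le> C * N powr (- 2 * s)"
    and F: "finite F" "\<And>j l. (j, l) \<in> F \<Longrightarrow> j + l \<in> G"
  shows "(\<Sum>(j, l)\<in>F. a j * b l) \<le> 4 powr (s / 2) / 2 * (Pb * (C + Ma) + Pa * (C + Mb)) * N powr - s"
proof -
  let ?w = "sob_weight (s / 2) :: int ^ 'd \<Rightarrow> real" and ?W = "sob_weight s :: int ^ 'd \<Rightarrow> real"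
  \<comment> \<open>The exponent is s/2 because the weights get squared, and
    \<open>sob_weight s\<close> is the square of \<open>sob_weight (s / 2)\<close>.\<close>
  define c where "c = (4::real) powr (s / 2)"
  have c: "c > 0" by (simp add: c_def)
  \<comment> \<open>The factor N^s balances the two squares: N^s times the tail N^(-2s), and N^(-s)
    times the bounded Sobolev sum, are both of order N^(-s).\<close>
  define h where "h x j l = N powr s * inverse (?W (j + l)) + N powr - s * (?W j * (x j)\<^sup>2)" for x j l
  have amgm: "?w j * x j / ?w (j + l) \<le> h x j l / 2" for x j l
  proof -
    let ?n = "N powr (s / 2)"
    have n: "?n\<^sup>2 = N powr s" "(inverse ?n)\<^sup>2 = N powr - s" "?n > 0"
      using N by (simp_all add: power2_eq_square powr_minus flip: powr_add inverse_mult_distrib)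
    have "y / w = (m * inverse w) * (inverse m * y)" if "m > 0" for m w y :: real
      using that by (simp add: divide_inverse)
    from this[OF n(3)]
    have "?w j * x j / ?w (j + l) = (?n * inverse (?w (j + l))) * (inverse ?n * (?w j * x j))" .
    also have "2 * \<dots> \<le> (?n * inverse (?w (j + l)))\<^sup>2 + (inverse ?n * (?w j * x j))\<^sup>2"
      by (rule sum_squares_bound[unfolded mult.assoc])
    also have "\<dots> = ?n\<^sup>2 * inverse ((?w (j + l))\<^sup>2) + (inverse ?n)\<^sup>2 * ((?w j)\<^sup>2 * (x j)\<^sup>2)"
      by (simp only: power_mult_distrib power_inverse)
    finally have "2 * (?w j * x j / ?w (j + l)) \<le> h x j l"
      unfolding h_def sob_weight_half_square n .
    then show ?thesis by linarith
  qed
  have pt: "a j * b l \<le> c / 2 * (b l * h a j l + a j * h b l j)" for j l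
  proof -
    have "?w (j + l) \<le> c * (?w j + ?w l)" unfolding c_def using s by (intro sob_weight_add_le) auto
    moreover have "1 \<le> c * (x / z + y / z)" if "z \<le> c * (x + y)" "z > 0" for x y z :: real
      using that by (simp add: field_simps)
    ultimately have "1 \<le> c * (?w j / ?w (j + l) + ?w l / ?w (l + j))"
      by (simp add: add.commute)
    then have "(a j * b l) * 1 \<le> (a j * b l) * (c * (?w j / ?w (j + l) + ?w l / ?w (l + j)))"
      using a(1) b(1) by (intro mult_left_mono) auto
    also have "\<dots> = c * (b l * (?w j * a j / ?w (j + l)) + a j * (?w l * b l / ?w (l + j)))"
      by (simp add: algebra_simps)
    also have "\<dots> \<le> c * (b l * (h a j l / 2) + a j * (h b l j / 2))"
      using a(1) b(1) c amgm by (intro mult_left_mono add_mono) auto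
    finally show ?thesis by (simp add: algebra_simps)
  qed
  have fin: "finite {j. (j, l) \<in> F}" "finite {l. (j, l) \<in> F}" for j l
    by (rule finite_subset[of _ "fst ` F"], use F in force, use F in force,
        rule finite_subset[of _ "snd ` F"], use F in force, use F in force)
  have NN: "N powr s * (C * N powr (- 2 * s)) = N powr - s * C"
    by (simp add: mult_ac flip: powr_add)
  have hD: "(\<Sum>j\<in>J. h x j l) \<le> N powr - s * (C + M)"
    if J: "finite J" "\<And>j. j \<in> J \<Longrightarrow> j + l \<in> G" and M: "(\<Sum>j\<in>J. ?W j * (x j)\<^sup>2) \<le> M" for J x l M
  proof -
    have "(\<Sum>j\<in>J. inverse (?W (j + l))) = (\<Sum>k\<in>(\<lambda>j. j + l) ` J. inverse (?W k))"
      by (subst sum.reindex) (auto simp: inj_on_def)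
    also have "\<dots> \<le> C * N powr (- 2 * s)" by (rule G) (use J in auto)
    finally have "N powr s * (\<Sum>j\<in>J. inverse (?W (j + l))) + N powr - s * (\<Sum>j\<in>J. ?W j * (x j)\<^sup>2)
        \<le> N powr s * (C * N powr (- 2 * s)) + N powr - s * M"
      using M by (intro add_mono mult_left_mono) auto
    then show ?thesis unfolding h_def NN by (simp add: sum.distrib sum_distrib_left distrib_left)
  qed
  have 1: "(\<Sum>(j, l)\<in>F. b l * h a j l) \<le> Pb * (N powr - s * (C + Ma))"
    using C by (intro sum_pairs_le F b hD fin a) auto
  \<comment> \<open>Here a and b exchange roles, so the fibres run over l for fixed j.\<close>
  have "(\<Sum>(l, j)\<in>prod.swap ` F. a j * h b l j) \<le> Pa * (N powr - s * (C + Mb))"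
  proof (intro sum_pairs_le a hD b)
    show "j + l \<in> G" if "j \<in> {j. (j, l) \<in> prod.swap ` F}" for j l
      using that F(2)[of l j] by (auto simp: add.commute)
  qed (use F fin C in \<open>auto simp: pair_in_swap_image\<close>)
  moreover have "(\<Sum>(l, j)\<in>prod.swap ` F. a j * h b l j) = (\<Sum>(j, l)\<in>F. a j * h b l j)"
    by (subst sum.reindex) (auto simp: case_prod_unfold)
  ultimately have 2: "(\<Sum>(j, l)\<in>F. a j * h b l j) \<le> Pa * (N powr - s * (C + Mb))" by simp
  have "(\<Sum>(j, l)\<in>F. a j * b l) \<le> (\<Sum>(j, l)\<in>F. c / 2 * (b l * h a j l + a j * h b l j))"
    by (intro sum_mono) (use pt in auto)
  also have "\<dots> = c / 2 * ((\<Sum>(j, l)\<in>F. b l * h a j l) + (\<Sum>(j, l)\<in>F. a j * h b l j))"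
    by (simp add: case_prod_unfold sum_distrib_left sum.distrib distrib_left)
  also have "\<dots> \<le> c / 2 * (Pb * (N powr - s * (C + Ma)) + Pa * (N powr - s * (C + Mb)))"
    using 1 2 c by (intro mult_left_mono add_mono) auto
  also have "\<dots> = c / 2 * (Pb * (C + Ma) + Pa * (C + Mb)) * N powr - s"
    by (simp add: algebra_simps)
  finally show ?thesis unfolding c_def .
qed

subsection \<open>Quadrature along a closed geodesic\<close>

text \<open>M bounds the square of the H^s norm, through finite partial sums. The coefficient family
  is a parameter, so that \<phi>, \<rho> and the constant 1 enter the quadrature estimate in the
  same form.\<close>

definition sobolev_series :: "real \<Rightarrow> real \<Rightarrow> (real ^ 'd \<Rightarrow> real) \<Rightarrow> (int ^ 'd \<Rightarrow> complex) \<Rightarrow> bool" where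
  "sobolev_series s M f a \<longleftrightarrow> continuous_on UNIV f \<and>
     (\<forall>x. ((\<lambda>k. a k * tchar k x) has_sum complex_of_real (f x)) UNIV) \<and>
     (\<forall>F. finite F \<longrightarrow> (\<Sum>k\<in>F. sob_weight s k * (norm (a k))\<^sup>2) \<le> M)"

text \<open>The Sobolev embedding on the Fourier side; 2x \<le> w x^2 + 1/w replaces Cauchy-Schwarz
  and keeps the constants free of square roots.\<close>

lemma norm_sum_le_sobolev:
  fixes a :: "int ^ 'd \<Rightarrow> complex"
  assumes "(\<Sum>k\<in>F. inverse (sob_weight s k)) \<le> C" "(\<Sum>k\<in>F. sob_weight s k * (norm (a k))\<^sup>2) \<le> M"
  shows "(\<Sum>k\<in>F. norm (a k)) \<le> (M + C) / 2"
proof -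
  have "2 * x \<le> w * x\<^sup>2 + inverse w" if "w > 0" for w x :: real
  proof -
    have "w * x\<^sup>2 + inverse w - 2 * x = w * (x - inverse w)\<^sup>2"
      using that by (simp add: power2_eq_square field_simps)
    moreover have "w * (x - inverse w)\<^sup>2 \<ge> 0" using that by simp
    ultimately show ?thesis by linarith
  qed
  then have "(\<Sum>k\<in>F. 2 * norm (a k)) \<le> (\<Sum>k\<in>F. sob_weight s k * (norm (a k))\<^sup>2 + inverse (sob_weight s k))"
    by (intro sum_mono) (meson sob_weight_pos)
  then have "2 * (\<Sum>k\<in>F. norm (a k)) \<le> M + C"
    using assms by (simp add: sum.distrib flip: sum_distrib_left)
  then show ?thesis by simp
qed

lemma sobolev_series_fourier:
  fixes f :: "real ^ 'd \<Rightarrow> real"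
  assumes s: "s > real CARD('d) / 2" and c: "continuous_on UNIV f" and Hs: "in_Hs s f"
    and M: "Hs_norm s f \<le> M"
  shows "sobolev_series s (M\<^sup>2) f (fourier_coeff f)"
proof -
  define u where "u k = sob_weight s k * (cmod (fourier_coeff f k))\<^sup>2" for k
  have u: "u k \<ge> 0" for k unfolding u_def by (intro mult_nonneg_nonneg less_imp_le[OF sob_weight_pos]) simp
  have su: "u summable_on UNIV" and per: "tor_periodic f"
    using Hs by (simp_all add: in_Hs_def u_def[abs_def])
  have "infsum u UNIV \<ge> 0" by (intro infsum_nonneg u)
  then have "infsum u UNIV = (Hs_norm s f)\<^sup>2" by (simp add: Hs_norm_def u_def[abs_def])
  also have "\<dots> \<le> M\<^sup>2"
    using M \<open>infsum u UNIV \<ge> 0\<close> by (intro power_mono) (simp_all add: Hs_norm_def u_def[abs_def])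
  finally have iM: "infsum u UNIV \<le> M\<^sup>2" .
  have uM: "sum u F \<le> M\<^sup>2" if "finite F" for F
    using finite_sum_le_infsum[OF su that] u iM by (meson order_trans subset_UNIV)
  obtain C where C: "\<And>F :: (int ^ 'd) set. finite F \<Longrightarrow> (\<Sum>k\<in>F. inverse (sob_weight s k)) \<le> C"
    using inverse_sob_weight_bounded[OF s] by blast
  have "(\<lambda>k. norm (fourier_coeff f k)) summable_on UNIV"
  proof (rule nonneg_bdd_above_summable_on)
    show "bdd_above (sum (\<lambda>k. norm (fourier_coeff f k)) ` {F. F \<subseteq> UNIV \<and> finite F})"
      by (rule bdd_aboveI2[where M = "(M\<^sup>2 + C) / 2"], rule norm_sum_le_sobolev[OF C uM[unfolded u_def]]) auto
  qed simp
  then show ?thesis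
    using fourier_series[OF c per] c uM by (simp add: sobolev_series_def u_def)
qed

lemma sobolev_series_one: "sobolev_series s 1 (\<lambda>_. 1) (\<lambda>k. if k = 0 then 1 else 0)"
  unfolding sobolev_series_def
proof (intro conjI allI impI)
  fix x :: "real ^ 'd"
  show "((\<lambda>k. (if k = 0 then 1 else 0) * tchar k x) has_sum complex_of_real 1) UNIV"
    by (rule has_sum_finite_neutralI[of "{0}"]) auto
next
  fix F :: "(int ^ 'd) set" assume "finite F"
  have "(\<Sum>k\<in>F. sob_weight s k * (cmod (if k = 0 then 1 else 0))\<^sup>2) = (\<Sum>k\<in>F. if k = 0 then 1 else 0)"
    by (intro sum.cong) (auto simp: sob_weight_def)
  also have "\<dots> \<le> 1" using \<open>finite F\<close> by simp
  finally show "(\<Sum>k\<in>F. sob_weight s k * (cmod (if k = 0 then 1 else 0))\<^sup>2) \<le> 1" .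
qed (rule continuous_on_const)

lemma norm_has_sum_le:
  fixes f :: "'k \<Rightarrow> 'b :: real_normed_vector"
  assumes "(f has_sum x) A" "\<And>F. finite F \<Longrightarrow> F \<subseteq> A \<Longrightarrow> norm (sum f F) \<le> B"
  shows "norm x \<le> B"
proof (rule tendsto_upperbound)
  show "((\<lambda>F. norm (sum f F)) \<longlongrightarrow> norm x) (finite_subsets_at_top A)"
    using assms(1) unfolding has_sum_def by (rule tendsto_norm)
  show "\<forall>\<^sub>F F in finite_subsets_at_top A. norm (sum f F) \<le> B"
    using assms(2) by (intro eventually_finite_subsets_at_top_weakI)
qed simp

lemma sobolev_series_bound:
  fixes f :: "real ^ 'd \<Rightarrow> real"
  assumes C: "\<And>F :: (int ^ 'd) set. finite F \<Longrightarrow> (\<Sum>k\<in>F. inverse (sob_weight s k)) \<le> C"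
    and f: "sobolev_series s M f a"
  shows "\<bar>f x\<bar> \<le> (M + C) / 2"
proof -
  have "norm (complex_of_real (f x)) \<le> (M + C) / 2"
  proof (rule norm_has_sum_le)
    show "((\<lambda>k. a k * tchar k x) has_sum complex_of_real (f x)) UNIV"
      using f by (simp add: sobolev_series_def)
    fix F :: "(int ^ 'd) set" assume F: "finite F"
    have "norm (\<Sum>k\<in>F. a k * tchar k x) \<le> (\<Sum>k\<in>F. norm (a k))"
      by (rule sum_norm_le) (simp add: norm_mult)
    also have "\<dots> \<le> (M + C) / 2"
      by (rule norm_sum_le_sobolev[OF C[OF F]]) (use f F in \<open>simp add: sobolev_series_def\<close>)
    finally show "norm (\<Sum>k\<in>F. a k * tchar k x) \<le> (M + C) / 2" .
  qed
  then show ?thesis by simp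
qed

section \<open>Double Fourier series of a product and its quadrature error\<close>

lemma has_sum_mult_pairs:
  fixes a b :: "'k \<Rightarrow> complex"
  assumes a: "(a has_sum x) UNIV" and b: "(b has_sum y) UNIV"
    and ab: "(\<lambda>(j, l). norm (a j * b l)) summable_on UNIV"
  shows "((\<lambda>(j, l). a j * b l) has_sum x * y) UNIV"
proof -
  have "((\<lambda>(j, l). a j * b l) has_sum x * y) (UNIV \<times> UNIV)"
  proof (rule has_sum_SigmaI)
    show "((\<lambda>l. case (j, l) of (j, l) \<Rightarrow> a j * b l) has_sum a j * y) UNIV" for j
      using has_sum_cmult_right[OF b] by simp
    show "((\<lambda>j. a j * y) has_sum x * y) UNIV" by (rule has_sum_cmult_left[OF a])
    have "(\<lambda>p. norm (case p of (j, l) \<Rightarrow> a j * b l)) summable_on UNIV"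
      using ab by (simp add: case_prod_unfold)
    then show "(\<lambda>(j, l). a j * b l) summable_on UNIV \<times> UNIV"
      using abs_summable_summable by simp
  qed
  then show ?thesis by simp
qed

lemma summable_norm_pairs:
  fixes a b :: "'k \<Rightarrow> complex"
  assumes a: "\<And>F. finite F \<Longrightarrow> (\<Sum>k\<in>F. norm (a k)) \<le> A" and b: "\<And>F. finite F \<Longrightarrow> (\<Sum>k\<in>F. norm (b k)) \<le> B"
  shows "(\<lambda>(j, l). norm (a j * b l)) summable_on UNIV"
proof (rule nonneg_bdd_above_summable_on)
  have "(\<Sum>(j, l)\<in>F. norm (a j * b l)) \<le> A * B" if F: "finite F" for F
  proof -
    have "(\<Sum>(j, l)\<in>F. norm (a j * b l)) \<le> (\<Sum>(j, l)\<in>fst ` F \<times> snd ` F. norm (a j * b l))"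
      using F by (intro sum_mono2) force+
    also have "\<dots> = (\<Sum>j\<in>fst ` F. norm (a j)) * (\<Sum>l\<in>snd ` F. norm (b l))"
      by (simp add: sum_product sum.cartesian_product norm_mult)
    also have "\<dots> \<le> A * B"
      using F a[of "{}"] by (intro mult_mono a b) (auto intro: sum_nonneg)
    finally show ?thesis .
  qed
  then show "bdd_above (sum (\<lambda>(j, l). norm (a j * b l)) ` {F. F \<subseteq> UNIV \<and> finite F})"
    by (intro bdd_aboveI2[where M = "A * B"]) auto
qed auto

text \<open>As k and v are integral, the character restricts to the line as a one-dimensional
  character of integer frequency k.v.\<close>

lemma integral_tchar_geodesic:
  "integral\<^sup>L (lebesgue_on {0..1}) (\<lambda>t. tchar k (t *\<^sub>R int_vec v)) =
     (if (\<Sum>i\<in>UNIV. k $ i * v $ i) = 0 then 1 else 0)"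
proof -
  have "tchar k (t *\<^sub>R int_vec v) = cis (2 * pi * of_int (\<Sum>i\<in>UNIV. k $ i * v $ i) * t)" for t
    by (simp add: tchar_def sum_distrib_left sum_distrib_right mult_ac)
  then show ?thesis by (simp only: integral_cis_unit)
qed

text \<open>Termwise integration keeps the pairs with j + l = 0 on the cube and those with (j + l).v
  = 0 on the curve. The former are among the latter, so the difference is a subseries, to which
  \<open>convolution_tail\<close> applies.\<close>

lemma geodesic_quadrature:
  fixes f g :: "real ^ 'd \<Rightarrow> real"
  assumes s: "s > 0" and N: "N > 0"
    and C: "C \<ge> 0" "\<And>F :: (int ^ 'd) set. finite F \<Longrightarrow> (\<Sum>k\<in>F. inverse (sob_weight s k)) \<le> C"
    and tail: "\<And>F :: (int ^ 'd) set. finite F \<Longrightarrow> F \<subseteq> {k. k \<noteq> 0 \<and> (\<Sum>i\<in>UNIV. k $ i * v $ i) = 0} \<Longrightarrow>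
        (\<Sum>k\<in>F. inverse (sob_weight s k)) \<le> C * N powr (- 2 * s)"
    and f: "sobolev_series s Mf f a" and g: "sobolev_series s Mg g b"
  shows "\<bar>integral\<^sup>L tor_measure (\<lambda>x. f x * g x) -
            integral\<^sup>L (lebesgue_on {0..1}) (\<lambda>t. f (t *\<^sub>R int_vec v) * g (t *\<^sub>R int_vec v))\<bar>
         \<le> 4 powr (s / 2) / 2 * ((C + Mf) * (C + Mg)) * N powr - s"
proof -
  define Z where "Z k \<longleftrightarrow> (\<Sum>i\<in>UNIV. k $ i * v $ i) = 0" for k :: "int ^ 'd"
  let ?T = "integral\<^sup>L tor_measure (\<lambda>x. f x * g x)"
  let ?U = "integral\<^sup>L (lebesgue_on {0..1}) (\<lambda>t. f (t *\<^sub>R int_vec v) * g (t *\<^sub>R int_vec v))"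
  have cf: "continuous_on UNIV f" and cg: "continuous_on UNIV g"
    and sf: "\<And>x. ((\<lambda>k. a k * tchar k x) has_sum complex_of_real (f x)) UNIV"
    and sg: "\<And>x. ((\<lambda>k. b k * tchar k x) has_sum complex_of_real (g x)) UNIV"
    and wf: "\<And>F. finite F \<Longrightarrow> (\<Sum>k\<in>F. sob_weight s k * (norm (a k))\<^sup>2) \<le> Mf"
    and wg: "\<And>F. finite F \<Longrightarrow> (\<Sum>k\<in>F. sob_weight s k * (norm (b k))\<^sup>2) \<le> Mg"
    using f g by (auto simp: sobolev_series_def)
  have M: "Mf \<ge> 0" "Mg \<ge> 0" using wf[of "{}"] wg[of "{}"] by auto
  note Pf = norm_sum_le_sobolev[OF C(2) wf] and Pg = norm_sum_le_sobolev[OF C(2) wg]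
  have ab: "(\<lambda>(j, l). norm (a j * b l)) summable_on UNIV"
    by (rule summable_norm_pairs[OF Pf Pg])
  let ?c = "\<lambda>p. case p of (j, l) \<Rightarrow> a j * b l" and ?e = "\<lambda>p. tchar (fst p + snd p)"
  have abs: "(\<lambda>p. norm (?c p)) summable_on UNIV" using ab by (simp add: case_prod_unfold)
  have sums: "((\<lambda>p. ?c p * ?e p x) has_sum complex_of_real (f x * g x)) UNIV" for x
    using has_sum_mult_pairs[OF sf[of x] sg[of x]] ab
    by (simp add: case_prod_unfold tchar_add norm_mult mult_ac)
  have cfg: "continuous_on UNIV (\<lambda>x. complex_of_real (f x * g x))"
    by (intro continuous_intros cf cg)
  have cv: "continuous_on UNIV (\<lambda>t. h (t *\<^sub>R int_vec v))" if "continuous_on UNIV h"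
    for h :: "real ^ 'd \<Rightarrow> complex"
  proof -
    have "continuous_on UNIV (h \<circ> (\<lambda>t. t *\<^sub>R int_vec v))"
      by (intro continuous_on_compose continuous_intros continuous_on_subset[OF that]) simp
    then show ?thesis by (simp add: o_def)
  qed
  have "((\<lambda>p. ?c p * integral\<^sup>L tor_measure (?e p)) has_sum
      integral\<^sup>L tor_measure (\<lambda>x. complex_of_real (f x * g x))) UNIV"
    by (rule has_sum_integral[OF finite_measure_tor integrable_continuous_tor[OF cfg]
          integrable_continuous_tor[OF continuous_on_tchar] _ sums abs]) simp
  then have 1: "((\<lambda>p. ?c p * (if fst p + snd p = 0 then 1 else 0)) has_sum complex_of_real ?T) UNIV"
    by (simp only: integral_tchar integral_complex_of_real)
  have "((\<lambda>p. ?c p * integral\<^sup>L (lebesgue_on {0..1}) (\<lambda>t. ?e p (t *\<^sub>R int_vec v))) has_sum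
      integral\<^sup>L (lebesgue_on {0..1}) (\<lambda>t. complex_of_real (f (t *\<^sub>R int_vec v) * g (t *\<^sub>R int_vec v)))) UNIV"
    by (rule has_sum_integral[OF finite_measure_unit integrable_continuous_unit[OF cv[OF cfg]]
          integrable_continuous_unit[OF cv[OF continuous_on_tchar]] _ sums abs]) simp
  then have 2: "((\<lambda>p. ?c p * (if Z (fst p + snd p) then 1 else 0)) has_sum complex_of_real ?U) UNIV"
    by (simp only: integral_tchar_geodesic integral_complex_of_real Z_def)
  have Z0: "Z 0" by (simp add: Z_def)
  have "((\<lambda>p. ?c p * (if Z (fst p + snd p) then 1 else 0) - ?c p * (if fst p + snd p = 0 then 1 else 0))
      has_sum complex_of_real ?U - complex_of_real ?T) UNIV"
    unfolding diff_conv_add_uminus by (rule has_sum_add[OF 2 has_sum_uminusI[OF 1]])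
  moreover have "?c p * (if Z (fst p + snd p) then 1 else 0) - ?c p * (if fst p + snd p = 0 then 1 else 0)
      = (if fst p + snd p \<noteq> 0 \<and> Z (fst p + snd p) then ?c p else 0)" for p
    using Z0 by auto
  ultimately have err: "((\<lambda>p. if fst p + snd p \<noteq> 0 \<and> Z (fst p + snd p) then ?c p else 0)
      has_sum complex_of_real (?U - ?T)) UNIV" by simp
  have "norm (complex_of_real (?U - ?T)) \<le> 4 powr (s / 2) / 2 *
      ((Mg + C) / 2 * (C + Mf) + (Mf + C) / 2 * (C + Mg)) * N powr - s"
  proof (rule norm_has_sum_le[OF err])
    fix F :: "((int ^ 'd) \<times> (int ^ 'd)) set" assume F: "finite F"
    let ?F = "{p \<in> F. fst p + snd p \<noteq> 0 \<and> Z (fst p + snd p)}"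
    have "(\<Sum>p\<in>F. if fst p + snd p \<noteq> 0 \<and> Z (fst p + snd p) then ?c p else 0) = (\<Sum>p\<in>?F. ?c p)"
      using F by (simp add: sum.inter_filter)
    also have "norm \<dots> \<le> (\<Sum>(j, l)\<in>?F. norm (a j) * norm (b l))"
      by (rule sum_norm_le) (auto simp: norm_mult)
    also have "\<dots> \<le> 4 powr (s / 2) / 2 * ((Mg + C) / 2 * (C + Mf) + (Mf + C) / 2 * (C + Mg)) * N powr - s"
      by (rule convolution_tail[where G = "{k. k \<noteq> 0 \<and> Z k}"])
        (use s N C(1) M Pf Pg wf wg tail F in \<open>auto simp: Z_def\<close>)
    finally show "norm (\<Sum>p\<in>F. if fst p + snd p \<noteq> 0 \<and> Z (fst p + snd p) then ?c p else 0) \<le>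
      4 powr (s / 2) / 2 * ((Mg + C) / 2 * (C + Mf) + (Mf + C) / 2 * (C + Mg)) * N powr - s" .
  qed
  \<comment> \<open>The absolute sums are bounded by (M + C) / 2, so each of the two terms is half
    of the product.\<close>
  moreover have "(Mg + C) / 2 * (C + Mf) + (Mf + C) / 2 * (C + Mg) = (C + Mf) * (C + Mg)"
    by (simp add: field_simps)
  ultimately show ?thesis by (simp add: abs_minus_commute flip: of_real_diff)
qed

section \<open>Choice of the direction v and of the scale N\<close>

lemma digits_zero:
  fixes a :: "nat \<Rightarrow> int"
  assumes "N > 0" "\<And>n. n < d \<Longrightarrow> \<bar>a n\<bar> < N" "(\<Sum>n<d. a n * N ^ n) = 0" "n < d"
  shows "a n = 0"
  using assms(2-4)
proof (induction d arbitrary: a n)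
  case (Suc d)
  have e: "(\<Sum>n<Suc d. a n * N ^ n) = a 0 + N * (\<Sum>n<d. a (Suc n) * N ^ n)"
    by (subst sum.lessThan_Suc_shift) (simp add: sum_distrib_left mult_ac)
  \<comment> \<open>Reduction modulo N: a multiple of N of absolute value below N is 0, and the
    remaining sum can be divided by N. The digits may be negative, which covers the signed entries
    of a frequency.\<close>
  then have "N dvd a 0"
    using Suc.prems(2) by (metis add_eq_0_iff dvd_minus_iff dvd_triv_left)
  then have a0: "a 0 = 0"
    using Suc.prems(1)[of 0] zdvd_not_zless[of "\<bar>a 0\<bar>" N] by (cases "a 0 = 0") auto
  then have "(\<Sum>n<d. a (Suc n) * N ^ n) = 0"
    using e Suc.prems(2) assms(1) by simp
  then have "a (Suc m) = 0" if "m < d" for m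
    using Suc.IH[of "\<lambda>n. a (Suc n)" m] Suc.prems(1) that by simp
  then show ?case
    using a0 Suc.prems(3) by (cases n) auto
qed simp

text \<open>An orthogonal frequency with all entries below N in absolute value is a signed base-N
  expansion of 0, hence 0. Only the size of single points is claimed; separation follows because the
  orthogonal frequencies form a group.\<close>

lemma closed_geodesic_direction:
  assumes N: "N \<ge> 1"
  shows "\<exists>v :: int ^ 'd. norm (int_vec v) \<le> real CARD('d) * real N ^ (CARD('d) - 1) \<and>
    (\<forall>k. k \<noteq> 0 \<longrightarrow> (\<Sum>i\<in>UNIV. k $ i * v $ i) = 0 \<longrightarrow> (\<exists>i. int N \<le> \<bar>k $ i\<bar>))"
proof -
  let ?d = "CARD('d)"
  \<comment> \<open>The index type carries no order, so an arbitrary enumeration assigns the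
    exponents 0, ..., d-1.\<close>
  obtain \<sigma> :: "'d \<Rightarrow> nat" where bij: "bij_betw \<sigma> UNIV {0..<?d}"
    using ex_bij_betw_finite_nat[of "UNIV :: 'd set"] by auto
  define v :: "int ^ 'd" where "v = (\<chi> i. int N ^ \<sigma> i)"
  have lt: "\<sigma> i < ?d" for i using bij by (auto simp: bij_betw_def)
  have le: "\<sigma> i \<le> ?d - 1" for i using lt[of i] by linarith
  have "norm (int_vec v) \<le> (\<Sum>i\<in>UNIV. \<bar>int_vec v $ i\<bar>)" by (rule norm_le_l1_cart)
  also have "\<dots> \<le> (\<Sum>i\<in>(UNIV :: 'd set). real N ^ (?d - 1))"
    using N le by (intro sum_mono) (auto simp: v_def intro!: power_increasing)
  finally have "norm (int_vec v) \<le> real ?d * real N ^ (?d - 1)" by simp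
  moreover have "\<exists>i. int N \<le> \<bar>k $ i\<bar>" if k: "k \<noteq> 0" "(\<Sum>i\<in>UNIV. k $ i * v $ i) = 0" for k :: "int ^ 'd"
  proof (rule ccontr)
    assume "\<not> (\<exists>i. int N \<le> \<bar>k $ i\<bar>)"
    then have small: "\<bar>k $ i\<bar> < int N" for i by (meson not_le)
    define \<tau> where "\<tau> = the_inv_into UNIV \<sigma>"
    have \<tau>: "\<tau> (\<sigma> i) = i" for i
      unfolding \<tau>_def using bij by (intro the_inv_into_f_f) (auto simp: bij_betw_def)
    have "(\<Sum>n<?d. k $ \<tau> n * int N ^ n) = (\<Sum>i\<in>UNIV. k $ i * int N ^ \<sigma> i)"
      using sum.reindex_bij_betw[OF bij, of "\<lambda>n. k $ \<tau> n * int N ^ n"]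
      by (simp add: \<tau> lessThan_atLeast0)
    also have "\<dots> = 0" using k(2) by (simp add: v_def)
    finally have z: "k $ \<tau> n = 0" if "n < ?d" for n
      using digits_zero[of "int N" ?d "\<lambda>n. k $ \<tau> n" n] small that N by simp
    have "k $ i = 0" for i using z[OF lt[of i]] by (simp add: \<tau>)
    then show False using k(1) by (simp add: vec_eq_iff)
  qed
  ultimately show ?thesis by blast
qed

text \<open>N is the integer part of the solution x of B x^q = L. Rounding costs at most a factor 2
  since x \<ge> 1, whence 2^s. For L below L0 no N \<ge> N0 is admissible, but there L^(-s/q) is
  bounded away from 0.\<close>

lemma scale_choice:
  fixes q B s :: real and N0 :: nat
  assumes q: "q > 0" and B: "B > 0" and s: "s > 0" and N0: "N0 \<ge> 1"
  shows "\<exists>c>0. \<forall>L\<ge>1. 1 \<le> c * L powr (- s / q) \<or>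
    (\<exists>N\<ge>N0. B * real N powr q \<le> L \<and> real N powr - s \<le> c * L powr (- s / q))"
proof -
  define L0 where "L0 = B * real N0 powr q"
  have L0: "L0 > 0" using B N0 by (simp add: L0_def)
  define c where "c = L0 powr (s / q) + 2 powr s * B powr (s / q)"
  have c: "c > 0" using L0 by (simp add: c_def add_pos_nonneg)
  have "1 \<le> c * L powr (- s / q)" if L: "L \<ge> 1" "L < L0" for L
  proof -
    have "1 \<le> (L0 / L) powr (s / q)" using L q s by (intro ge_one_powr_ge_zero) auto
    also have "\<dots> = L0 powr (s / q) * L powr (- s / q)"
      using L L0 by (simp add: powr_divide powr_minus_divide)
    also have "\<dots> \<le> c * L powr (- s / q)"
      unfolding c_def by (intro mult_right_mono) auto
    finally show ?thesis .
  qed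
  moreover have "\<exists>N\<ge>N0. B * real N powr q \<le> L \<and> real N powr - s \<le> c * L powr (- s / q)"
    if L: "L \<ge> 1" "L \<ge> L0" for L
  proof -
    define x where "x = (L / B) powr (1 / q)"
    have xq: "x powr q = L / B" using q L B by (simp add: x_def powr_powr)
    have "real N0 = (real N0 powr q) powr (1 / q)" using q N0 by (simp add: powr_powr)
    also have "\<dots> \<le> x" unfolding x_def
      using L B q by (intro powr_mono2) (auto simp: L0_def field_simps)
    finally have x: "real N0 \<le> x" .
    define N where "N = nat \<lfloor>x\<rfloor>"
    have N: "N0 \<le> N" "real N \<le> x" "x < real N + 1"
      using x N0 by (auto simp: N_def le_nat_floor)
    have "real N powr q \<le> x powr q" using N q by (intro powr_mono2) auto
    then have "B * real N powr q \<le> L" using B by (simp add: xq field_simps)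
    moreover have "real N powr - s \<le> (x / 2) powr - s"
    proof (rule powr_mono2')
      have "1 \<le> N" using N(1) N0 by (rule le_trans[rotated])
      then show "x / 2 \<le> real N" using N(3) by simp
    qed (use x N0 s in auto)
    moreover have "(x / 2) powr - s = 2 powr s * B powr (s / q) * L powr (- s / q)"
    proof -
      have "x powr - s = (x powr q) powr (- s / q)" using q by (simp add: powr_powr)
      also have "\<dots> = B powr (s / q) * L powr (- s / q)"
        unfolding xq using B L by (simp add: powr_divide powr_minus_divide)
      finally have "x powr - s = B powr (s / q) * L powr (- s / q)" .
      moreover have "(x / 2) powr - s = 2 powr s * x powr - s"
        using x by (simp add: powr_divide powr_minus_divide)
      ultimately show ?thesis by simp
    qed
    moreover have "2 powr s * B powr (s / q) * L powr (- s / q) \<le> c * L powr (- s / q)"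
      unfolding c_def by (intro mult_right_mono) auto
    ultimately show ?thesis using N(1) by (intro exI[of _ N]) auto
  qed
  ultimately show ?thesis using c by (meson not_le)
qed

section \<open>The torus distance\<close>

lemma bdd_below_tor_dist: "bdd_below (range (\<lambda>k :: int ^ 'd. norm (x - y - int_vec k)))"
  by (intro bdd_belowI2[where m = 0]) simp

lemma tor_dist_nonneg: "tor_dist x y \<ge> 0"
  unfolding tor_dist_def by (intro cINF_greatest) auto

lemma tor_dist_le_norm: "tor_dist x y \<le> norm (x - y)"
  unfolding tor_dist_def using cINF_lower[OF bdd_below_tor_dist, of 0 x y] by simp

lemma tor_dist_int_vec: "tor_dist 0 (int_vec v) = 0"
proof (rule antisym)
  show "tor_dist 0 (int_vec v) \<le> 0"
    unfolding tor_dist_def using cINF_lower[OF bdd_below_tor_dist, of "- v" 0 "int_vec v"] by simp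
qed (rule tor_dist_nonneg)

lemma tor_lipschitzE:
  assumes "tor_lipschitz f"
  obtains C where "C \<ge> 0" "\<And>x y. \<bar>f x - f y\<bar> \<le> C * norm (x - y)"
proof -
  obtain C where C: "\<And>x y. \<bar>f x - f y\<bar> \<le> C * tor_dist x y"
    using assms by (auto simp: tor_lipschitz_def)
  have "\<bar>f x - f y\<bar> \<le> max C 0 * norm (x - y)" for x y
  proof -
    have "C * tor_dist x y \<le> max C 0 * norm (x - y)"
      using tor_dist_nonneg tor_dist_le_norm by (intro mult_mono) auto
    then show ?thesis using C[of x y] by linarith
  qed
  then show ?thesis using that[of "max C 0"] by simp
qed

text \<open>The norm equivalence bounds the H^s norm of f by the RKHS norm of some g that agrees
  with f almost everywhere. Both lie in the RKHS, hence are continuous, so g = f and the H^s norm is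
  at most 1 / c1.\<close>

lemma rkhs_unit_ball_sobolev:
  fixes K :: "real ^ 'd \<Rightarrow> real ^ 'd \<Rightarrow> real"
  assumes s: "s > real CARD('d) / 2"
    and K_cont: "continuous_on UNIV (\<lambda>(x, y). K x y)"
    and K_per: "\<forall>x y k. K (x + int_vec k) y = K x y \<and> K x (y + int_vec k) = K x y"
    and K_pd: "pos_def_kernel K"
    and c1: "c1 > 0"
    and sub: "\<And>f. in_rkhs K f \<Longrightarrow> in_Hs s f"
    and super: "\<And>f. in_Hs s f \<Longrightarrow> \<exists>g. in_rkhs K g \<and> (AE x in tor_measure. g x = f x) \<and>
                  c1 * Hs_norm s f \<le> rkhs_norm K g"
    and f: "in_rkhs K f" "rkhs_norm K f \<le> 1"
  shows "sobolev_series s ((1 / c1)\<^sup>2) f (fourier_coeff f)"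
proof -
  have "continuous_on UNIV (\<lambda>y. K y y)"
  proof -
    have "continuous_on UNIV ((\<lambda>(x, y). K x y) \<circ> (\<lambda>y. (y, y)))"
      by (intro continuous_on_compose continuous_on_Pair continuous_on_id continuous_on_subset[OF K_cont]) simp
    then show ?thesis by (simp add: o_def)
  qed
  moreover have "tor_periodic (\<lambda>y. K y y)" using K_per by (simp add: tor_periodic_def)
  ultimately obtain B where B: "B > 0" "\<And>y. norm (K y y) \<le> B" using torus_bounded by blast
  have Ky: "K y y \<le> B" for y using B(2)[of y] by (simp add: abs_le_iff)
  note cont = in_rkhs_continuous[OF K_cont K_pd B(1) Ky]
  obtain g where g: "in_rkhs K g" "AE x in tor_measure. g x = f x" "c1 * Hs_norm s f \<le> rkhs_norm K g"
    using super[OF sub[OF f(1)]] by blast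
  have "g x - f x = 0" for x
  proof (rule continuous_AE_zero)
    show "continuous_on UNIV (\<lambda>x. g x - f x)" by (intro continuous_on_diff cont g f)
    show "tor_periodic (\<lambda>x. g x - f x)"
      using sub[OF g(1)] sub[OF f(1)] by (simp add: in_Hs_def tor_periodic_def)
    show "AE x in tor_measure. g x - f x = 0" using g(2) by simp
  qed
  then have "g = f" by (simp add: fun_eq_iff)
  then have "Hs_norm s f \<le> 1 / c1" using g(3) f(2) c1 by (simp add: field_simps)
  then show ?thesis by (intro sobolev_series_fourier s cont f sub)
qed

theorem theorem6:
  fixes K :: "real ^ 'd \<Rightarrow> real ^ 'd \<Rightarrow> real"
    and s :: real
    and \<rho> :: "real ^ 'd \<Rightarrow> real"
  assumes dim: "CARD('d) \<ge> 2"
    and s_gt: "s > real CARD('d) / 2"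
    and K_cont: "continuous_on UNIV (\<lambda>(x, y). K x y)"
    and K_per: "\<forall>x y k. K (x + int_vec k) y = K x y \<and> K x (y + int_vec k) = K x y"
    and K_pd: "pos_def_kernel K"
    and HK_eq_Hs: "\<exists>c1 c2. c1 > 0 \<and> c2 > 0 \<and>
        (\<forall>f. in_rkhs K f \<longrightarrow> in_Hs s f \<and> rkhs_norm K f \<le> c2 * Hs_norm s f) \<and>
        (\<forall>f. in_Hs s f \<longrightarrow> (\<exists>g. in_rkhs K g \<and> (AE x in tor_measure. g x = f x) \<and>
                                   c1 * Hs_norm s f \<le> rkhs_norm K g))"
    and rho_nonneg: "\<forall>x. \<rho> x \<ge> 0"
    and rho_prob: "integral\<^sup>L tor_measure \<rho> = 1"
    and rho_lip: "tor_lipschitz \<rho>"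
    and rho_Hs: "in_Hs s \<rho>"
  shows "\<exists>c>0. \<forall>L\<ge>1. \<exists>\<gamma> w. acurve L \<gamma> w \<and>
           discrepancy_curve K \<rho> \<gamma> w \<le> ereal (c * L powr (- s / (real CARD('d) - 1)))"
proof -
  let ?d = "real CARD('d)"
  let ?I = "integral\<^sup>L (lebesgue_on {0..1 :: real})"
  have s: "s > 0" using s_gt dim by simp
  obtain c1 where c1: "c1 > 0" and sub: "\<And>f. in_rkhs K f \<Longrightarrow> in_Hs s f"
    and super: "\<And>f. in_Hs s f \<Longrightarrow> \<exists>g. in_rkhs K g \<and> (AE x in tor_measure. g x = f x) \<and>
                  c1 * Hs_norm s f \<le> rkhs_norm K g"
    using HK_eq_Hs by blast
  define M where "M = (1 / c1)\<^sup>2"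
  have ball: "sobolev_series s M \<phi> (fourier_coeff \<phi>)" if "in_rkhs K \<phi>" "rkhs_norm K \<phi> \<le> 1" for \<phi>
    unfolding M_def by (rule rkhs_unit_ball_sobolev[OF s_gt K_cont K_per K_pd c1 sub super that])
  obtain lip where lip: "lip \<ge> 0" "\<And>x y. \<bar>\<rho> x - \<rho> y\<bar> \<le> lip * norm (x - y)"
    using tor_lipschitzE[OF rho_lip] by blast
  have "lip-lipschitz_on UNIV \<rho>" using lip by (intro lipschitz_onI) (auto simp: dist_norm)
  then have cont_rho: "continuous_on UNIV \<rho>" by (rule lipschitz_on_continuous_on)
  define R where "R = (Hs_norm s \<rho>)\<^sup>2"
  have rho: "sobolev_series s R \<rho> (fourier_coeff \<rho>)"
    unfolding R_def by (intro sobolev_series_fourier s_gt cont_rho rho_Hs order_refl)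
  obtain C1 where C1: "C1 > 0" "\<And>F :: (int ^ 'd) set. finite F \<Longrightarrow> (\<Sum>k\<in>F. inverse (sob_weight s k)) \<le> C1"
    using inverse_sob_weight_bounded[OF s_gt] by blast
  obtain C2 where C2: "C2 > 0" "\<And>(N::nat) (G :: (int ^ 'd) set) F. N \<ge> 1 \<Longrightarrow> finite F \<Longrightarrow> F \<subseteq> G \<Longrightarrow>
      \<forall>k\<in>G. \<exists>i. int N \<le> \<bar>k $ i\<bar> \<Longrightarrow> \<forall>k\<in>G. \<forall>l\<in>G. k \<noteq> l \<longrightarrow> (\<exists>i. int N \<le> \<bar>k $ i - l $ i\<bar>) \<Longrightarrow>
      (\<Sum>k\<in>F. inverse (sob_weight s k)) \<le> C2 * real N powr (- 2 * s)"
    using separated_sum_bounded[OF s_gt] by metis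
  \<comment> \<open>One constant for the full sum and for the tail, as
    \<open>geodesic_quadrature\<close> expects.\<close>
  define C where "C = C1 + C2"
  have C: "C \<ge> 0" "\<And>F :: (int ^ 'd) set. finite F \<Longrightarrow> (\<Sum>k\<in>F. inverse (sob_weight s k)) \<le> C"
    using C1(1) C2(1) by (auto simp: C_def intro!: add_increasing2 C1(2))
  have "M \<ge> 0" "R \<ge> 0" by (simp_all add: M_def R_def)
  define E1 where "E1 = 4 powr (s / 2) / 2 * ((C + M) * (C + R))"
  define E2 where "E2 = 4 powr (s / 2) / 2 * ((C + 1) * (C + R))"
  define S where "S = (M + C) / 2"
  define S' where "S' = (R + C) / 2"
  have nonneg: "E1 \<ge> 0" "E2 \<ge> 0" "S \<ge> 0" "S' \<ge> 0"
    using C(1) \<open>M \<ge> 0\<close> \<open>R \<ge> 0\<close> by (simp_all add: E1_def E2_def S_def S'_def)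
  have phi_le: "\<bar>\<phi> x\<bar> \<le> S" if "in_rkhs K \<phi>" "rkhs_norm K \<phi> \<le> 1" for \<phi> x
    unfolding S_def by (rule sobolev_series_bound[OF C(2) ball[OF that]])
  have rho_le: "\<bar>\<rho> x\<bar> \<le> S'" for x
    unfolding S'_def by (rule sobolev_series_bound[OF C(2) rho])
  \<comment> \<open>E1 comes from the quadrature of \<phi> \<rho>. The other term is the cost of
    normalising: |1 - A| \<le> E2 N^(-s), times |J| \<le> S S', divided by A > 1/2.\<close>
  define E where "E = E1 + 2 * E2 * (S * S')"
  \<comment> \<open>L has to dominate the speed |v| and the Lipschitz constant of the weight, which
    is at most 2 lip |v| because A > 1/2. The factor 1 + 2 lip covers both, and |v| \<le> d
    N^(d-1).\<close>
  define B where "B = ?d * (1 + 2 * lip)"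
  have B: "B > 0" unfolding B_def using lip(1) by (intro mult_pos_pos) (auto simp: card_gt_0_iff)
  have "(\<lambda>N. E2 * real N powr - s) \<longlonglongrightarrow> E2 * 0"
    using s by (intro tendsto_intros tendsto_neg_powr filterlim_real_sequentially) auto
  then have "\<forall>\<^sub>F N in sequentially. E2 * real N powr - s < 1 / 2"
    by (intro order_tendstoD(2)) auto
  then obtain N1 where N1: "\<And>N. N \<ge> N1 \<Longrightarrow> E2 * real N powr - s < 1 / 2"
    by (auto simp: eventually_sequentially)
  \<comment> \<open>From N1 on the normalising constant is within 1/2 of 1; the maximum excludes N =
    0.\<close>
  define N0 where "N0 = max N1 1"
  have q: "?d - 1 > 0" using dim by simp

  have geodesic: "\<exists>\<gamma> w. acurve L \<gamma> w \<and> discrepancy_curve K \<rho> \<gamma> w \<le> ereal (E * real N powr - s)"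
    if N: "N \<ge> N0" and BN: "B * real N powr (?d - 1) \<le> L" and L: "L \<ge> 1" for N :: nat and L
  proof -
    have N': "N \<ge> 1" "N \<ge> N1" using N by (auto simp: N0_def)
    obtain v :: "int ^ 'd" where v: "norm (int_vec v) \<le> ?d * real N ^ (CARD('d) - 1)"
        "\<And>k. k \<noteq> 0 \<Longrightarrow> (\<Sum>i\<in>UNIV. k $ i * v $ i) = 0 \<Longrightarrow> \<exists>i. int N \<le> \<bar>k $ i\<bar>"
      using closed_geodesic_direction[OF N'(1)] by blast
    define \<gamma> where "\<gamma> t = t *\<^sub>R int_vec v" for t :: real
    have vL: "norm (int_vec v) * (1 + 2 * lip) \<le> L"
    proof -
      have "norm (int_vec v) * (1 + 2 * lip) \<le> ?d * real N ^ (CARD('d) - 1) * (1 + 2 * lip)"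
        using v(1) lip(1) by (intro mult_right_mono) auto
      also have "\<dots> = B * real N powr (?d - 1)"
        using N'(1) dim by (simp add: B_def powr_realpow of_nat_diff flip: powr_realpow)
      finally show ?thesis using BN by simp
    qed
    let ?G = "{k. k \<noteq> 0 \<and> (\<Sum>i\<in>UNIV. k $ i * v $ i) = 0}"
    have tail: "(\<Sum>k\<in>F. inverse (sob_weight s k)) \<le> C * real N powr (- 2 * s)"
      if F: "finite F" "F \<subseteq> ?G" for F
    proof -
      \<comment> \<open>The difference of two orthogonal frequencies is orthogonal and nonzero, so
        the lower bound for single points gives the separation.\<close>
      have "\<exists>i. int N \<le> \<bar>k $ i - l $ i\<bar>" if "k \<in> ?G" "l \<in> ?G" "k \<noteq> l" for k l
        using v(2)[of "k - l"] that by (simp add: left_diff_distrib sum_subtractf)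
      then have "(\<Sum>k\<in>F. inverse (sob_weight s k)) \<le> C2 * real N powr (- 2 * s)"
        by (intro C2(2)[OF N'(1) F]) (use v(2) in auto)
      also have "\<dots> \<le> C * real N powr (- 2 * s)"
        unfolding C_def using C1(1) by (intro mult_right_mono) auto
      finally show ?thesis .
    qed
    have N0': "real N > 0" using N'(1) by simp
    have quad: "\<bar>integral\<^sup>L tor_measure (\<lambda>x. f x * \<rho> x) - ?I (\<lambda>t. f (\<gamma> t) * \<rho> (\<gamma> t))\<bar>
        \<le> 4 powr (s / 2) / 2 * ((C + Mf) * (C + R)) * real N powr - s"
      if "sobolev_series s Mf f a" for f Mf a
      unfolding \<gamma>_def
      by (rule geodesic_quadrature[OF s N0' C(1) _ _ that rho], erule C(2), erule (1) tail)
    define A where "A = ?I (\<lambda>t. \<rho> (\<gamma> t))"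
    have A: "\<bar>1 - A\<bar> \<le> E2 * real N powr - s"
      using quad[OF sobolev_series_one] rho_prob by (simp add: A_def E2_def)
    then have A': "A > 1 / 2" using N1[OF N'(2)] by linarith
    define w where "w t = \<rho> (\<gamma> t) / A" for t
    have "acurve L \<gamma> w"
      unfolding acurve_def
    proof (intro conjI ballI)
      fix t u :: real
      have nv: "norm (\<gamma> t - \<gamma> u) = norm (int_vec v) * \<bar>t - u\<bar>"
        by (simp add: \<gamma>_def flip: scaleR_diff_left)
      have "norm (int_vec v) * 1 \<le> norm (int_vec v) * (1 + 2 * lip)"
        using lip(1) by (intro mult_left_mono) auto
      then have "norm (int_vec v) \<le> L" using vL by linarith
      then have "norm (int_vec v) * \<bar>t - u\<bar> \<le> L * \<bar>t - u\<bar>" by (rule mult_right_mono) simp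
      then show "tor_dist (\<gamma> t) (\<gamma> u) \<le> L * \<bar>t - u\<bar>"
        using tor_dist_le_norm[of "\<gamma> t" "\<gamma> u"] unfolding nv by linarith
    next
      show "tor_dist (\<gamma> 0) (\<gamma> 1) = 0" by (simp add: \<gamma>_def tor_dist_int_vec)
    next
      show "w t \<ge> 0" for t using rho_nonneg A' by (simp add: w_def)
    next
      show "?I w = 1" using A' by (simp add: w_def[abs_def] A_def[symmetric])
    next
      show "L-lipschitz_on {0..1} w"
      proof (rule lipschitz_onI)
        fix t u :: real
        have "dist (w t) (w u) = \<bar>\<rho> (\<gamma> t) - \<rho> (\<gamma> u)\<bar> / A"
          using A' by (simp add: w_def dist_real_def flip: diff_divide_distrib)
        also have "\<dots> \<le> (lip * norm (\<gamma> t - \<gamma> u)) / (1 / 2)"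
          using A' lip by (intro frac_le) auto
        also have "\<dots> = (norm (int_vec v) * (2 * lip)) * dist t u"
          by (simp add: \<gamma>_def dist_real_def flip: scaleR_diff_left)
        also have "\<dots> \<le> L * dist t u"
        proof (rule mult_right_mono)
          have "norm (int_vec v) * (2 * lip) \<le> norm (int_vec v) * (1 + 2 * lip)"
            by (intro mult_left_mono) auto
          then show "norm (int_vec v) * (2 * lip) \<le> L" using vL by linarith
        qed simp
        finally show "dist (w t) (w u) \<le> L * dist t u" .
      qed (use L in simp)
    qed
    moreover have "\<bar>dens_int \<rho> \<phi> - curve_int \<gamma> w \<phi>\<bar> \<le> E * real N powr - s"
      if phi: "in_rkhs K \<phi>" "rkhs_norm K \<phi> \<le> 1" for \<phi>
    proof -
      define J where "J = ?I (\<lambda>t. \<phi> (\<gamma> t) * \<rho> (\<gamma> t))"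
      have 1: "\<bar>dens_int \<rho> \<phi> - J\<bar> \<le> E1 * real N powr - s"
        using quad[OF ball[OF phi]] by (simp add: dens_int_def J_def E1_def)
      have ci: "curve_int \<gamma> w \<phi> = J / A" by (simp add: curve_int_def w_def J_def)
      have "\<bar>J\<bar> \<le> ?I (\<lambda>t. S * S')"
      proof -
        interpret finite_measure "lebesgue_on {0..1 :: real}" by (rule finite_measure_unit)
        have cg: "continuous_on UNIV \<gamma>" unfolding \<gamma>_def by (intro continuous_intros)
        have cp: "continuous_on UNIV \<phi>" using ball[OF phi] by (simp add: sobolev_series_def)
        have cc: "continuous_on UNIV (\<lambda>t. \<phi> (\<gamma> t) * \<rho> (\<gamma> t))"
          by (intro continuous_on_mult continuous_on_compose2[OF cp cg] continuous_on_compose2[OF cont_rho cg]) simp_all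
        have le: "\<bar>\<phi> (\<gamma> t) * \<rho> (\<gamma> t)\<bar> \<le> S * S'" for t
          unfolding abs_mult by (rule mult_mono[OF phi_le[OF phi] rho_le]) (simp_all add: nonneg)
        have "\<bar>J\<bar> \<le> ?I (\<lambda>t. \<bar>\<phi> (\<gamma> t) * \<rho> (\<gamma> t)\<bar>)"
          unfolding J_def by (rule integral_abs_bound)
        also have "\<dots> \<le> ?I (\<lambda>t. S * S')"
          by (intro integral_mono integrable_abs[OF integrable_continuous_unit[OF cc]] integrable_const le)
        finally show ?thesis .
      qed
      then have J: "\<bar>J\<bar> \<le> S * S'" by simp
      have "J - J / A = (A - 1) * (J / A)" using A' by (simp add: field_simps)
      then have "\<bar>J - J / A\<bar> = \<bar>1 - A\<bar> * (\<bar>J\<bar> / A)" using A' by (simp add: abs_mult abs_minus_commute)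
      also have "\<dots> \<le> (E2 * real N powr - s) * (S * S' / (1 / 2))"
        using A A' J nonneg by (intro mult_mono frac_le) auto
      finally have "\<bar>J - J / A\<bar> \<le> 2 * E2 * (S * S') * real N powr - s" by (simp add: mult_ac)
      with 1 show ?thesis unfolding ci E_def distrib_right by linarith
    qed
    ultimately show ?thesis
      by (intro exI[of _ \<gamma>] exI[of _ w]) (auto simp: discrepancy_curve_def intro!: SUP_least)
  qed

  \<comment> \<open>The point mass at 0: both integrals are at most S in absolute value. This is
    enough where the rate is bounded below.\<close>
  have const_curve: "\<exists>\<gamma> w. acurve L \<gamma> w \<and> discrepancy_curve K \<rho> \<gamma> w \<le> ereal (2 * S)" if L: "L \<ge> 1" for L
  proof -
    have "acurve L (\<lambda>_. 0 :: real ^ 'd) (\<lambda>_. 1)"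
      using L tor_dist_int_vec[of "0 :: int ^ 'd"] by (simp add: acurve_def lipschitz_on_def)
    moreover have "\<bar>dens_int \<rho> \<phi> - curve_int (\<lambda>_. 0) (\<lambda>_. 1) \<phi>\<bar> \<le> 2 * S"
      if phi: "in_rkhs K \<phi>" "rkhs_norm K \<phi> \<le> 1" for \<phi>
    proof -
      have cp: "continuous_on UNIV \<phi>" using ball[OF phi] by (simp add: sobolev_series_def)
      have "\<bar>dens_int \<rho> \<phi>\<bar> \<le> integral\<^sup>L tor_measure (\<lambda>x. \<bar>\<phi> x * \<rho> x\<bar>)"
        unfolding dens_int_def by (rule integral_abs_bound)
      also have "\<dots> \<le> integral\<^sup>L tor_measure (\<lambda>x. S * \<rho> x)"
        using phi_le[OF phi] rho_nonneg cp cont_rho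
        by (intro integral_mono integrable_abs integrable_continuous_tor continuous_on_mult
            continuous_on_const) (auto simp: abs_mult intro!: mult_right_mono)
      also have "\<dots> = S" using rho_prob by simp
      finally have "\<bar>dens_int \<rho> \<phi>\<bar> \<le> S" .
      moreover have "curve_int (\<lambda>_. 0) (\<lambda>_. 1) \<phi> = \<phi> 0" by (simp add: curve_int_def)
      ultimately show ?thesis using phi_le[OF phi, of 0] by linarith
    qed
    ultimately show ?thesis
      by (intro exI[of _ "\<lambda>_. 0"] exI[of _ "\<lambda>_. 1"]) (auto simp: discrepancy_curve_def intro!: SUP_least)
  qed

  obtain c where c: "c > 0" "\<And>L. L \<ge> 1 \<Longrightarrow> 1 \<le> c * L powr (- s / (?d - 1)) \<or>
      (\<exists>N\<ge>N0. B * real N powr (?d - 1) \<le> L \<and> real N powr - s \<le> c * L powr (- s / (?d - 1)))"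
    using scale_choice[OF q B s, of N0] by (auto simp: N0_def)
  \<comment> \<open>E and 2 S serve the two cases of \<open>scale_choice\<close>; the summand 1
    ensures that D is positive.\<close>
  define D where "D = E + 2 * S + 1"
  have ES: "E \<ge> 0" using nonneg by (simp add: E_def)
  have D: "D > 0" "E \<le> D" "2 * S \<le> D" using ES nonneg by (auto simp: D_def)
  have "\<exists>\<gamma> w. acurve L \<gamma> w \<and> discrepancy_curve K \<rho> \<gamma> w \<le> ereal (D * c * L powr (- s / (?d - 1)))"
    if L: "L \<ge> 1" for L
  proof -
    let ?r = "c * L powr (- s / (?d - 1))"
    have r: "?r \<ge> 0" using c(1) by simp
    have *: ?thesis if "\<exists>\<gamma> w. acurve L \<gamma> w \<and> discrepancy_curve K \<rho> \<gamma> w \<le> ereal y" "y \<le> D * ?r" for y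
      using that by (metis ereal_less_eq(3) mult.assoc order_trans)
    from c(2)[OF L] show ?thesis
    proof
      assume "1 \<le> ?r"
      then have "2 * S * 1 \<le> D * ?r" using D nonneg by (intro mult_mono) auto
      then show ?thesis using *[OF const_curve[OF L]] by simp
    next
      assume "\<exists>N\<ge>N0. B * real N powr (?d - 1) \<le> L \<and> real N powr - s \<le> ?r"
      then obtain N where N: "N \<ge> N0" "B * real N powr (?d - 1) \<le> L" "real N powr - s \<le> ?r" by blast
      have "E * real N powr - s \<le> D * ?r" using N(3) D ES by (intro mult_mono) auto
      then show ?thesis using *[OF geodesic[OF N(1,2) L]] by simp
    qed
  qed
  then show ?thesis using D(1) c(1) by (intro exI[of _ "D * c"]) auto
qed

end
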